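(* Let $1\le q\le\infty$ and assume that $\Phi^{(q)}$, and hence $J$, is strictly convex. Assume moreover that there is $\gamma>0$ with $\omega_\lambda\ge\gamma$ for all $\lambda\in\Lambda$. Then the sequence $(u^{(n)},v^{(n)})_{n\in\mathbb{N}}$ generated by the alternating minimization $$u^{(n)}:=\arg\min_{u\in\ell_2(\Lambda,\mathbb{R}^M)}J(u,v^{(n-1)}),\qquad v^{(n)}:=\arg\min_{v\in\ell_{\infty,\rho^{-1}}(\Lambda)_+}J(u^{(n)},v)$$ converges to the unique minimizer $(u^*,v^* )\in\ell_2(\Lambda,\mathbb{R}^M)\times\ell_{\infty,\rho^{-1}}(\Lambda)_+$ of $J$, where $u^{(n)}\to u^*$ weakly in $\ell_2(\Lambda,\mathbb{R}^M)$ and $v^{(n)}\to v^*$ componentwise. Furthermore, if $q\in\{1,2,\infty\}$ and in addition there is $\sigma$ with $\theta_\lambda\omega_\lambda\ge\sigma>\phi_q/4$ for all $\lambda\in\Lambda$, where $\phi_1=M$, $\phi_2=1$, $\phi_\infty=\sqrt{M}$, then $u^{(n)}\to u^*$ also strongly in $\ell_2(\Lambda,\mathbb{R}^M)$ and $v^{(n)}-v^*\to0$ strongly in $\ell_{2,\theta}(\Lambda)$.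
   Context: Let $\Lambda$ be a countable index set and $M,N\in\mathbb{N}$. Let $\mathcal{K}$ and $\mathcal{H}_1,\dots,\mathcal{H}_N$ be separable real Hilbert spaces, $\mathcal{H}=\bigoplus_{j=1}^N\mathcal{H}_j$, $g=(g_j)_j\in\mathcal{H}$, let $A_{\ell,j}:\mathcal{K}\to\mathcal{H}_j$ ($\ell=1,\dots,M$, $j=1,\dots,N$) be bounded linear operators, $\{\psi_\lambda\}_{\lambda\in\Lambda}$ a frame of $\mathcal{K}$ and $F:\ell_2(\Lambda)\to\mathcal{K}$, $Fc=\sum_\lambda c_\lambda\psi_\lambda$. The space $\ell_2(\Lambda,\mathbb{R}^M)$ consists of $u=(u_\lambda)_{\lambda\in\Lambda}$, $u_\lambda=(u_\lambda^\ell)_{\ell=1}^M\in\mathbb{R}^M$, with norm $\|u\|_2=(\sum_\lambda\|u_\lambda\|_2^2)^{1/2}$, and $u^\ell=(u^\ell_\lambda)_\lambda$. Let $T:\ell_2(\Lambda,\mathbb{R}^M)\to\mathcal{H}$ be the bounded linear operator $Tu=\big(\sum_{\ell=1}^M A_{\ell,j}Fu^\ell\big)_{j=1}^N$. Let $(\omega_\lambda),(\theta_\lambda),(\rho_\lambda)$ be sequences of positive numbers indexed by $\Lambda$. Let $\ell_{\infty,\rho^{-1}}(\Lambda)_+$ be the convex cone of non-negative sequences $(v_\lambda)$ with $\sup_\lambda v_\lambda/\rho_\lambda<\infty$, and let $\ell_{2,\theta}(\Lambda)$ be the space of real sequences with norm $(\sum_\lambda\theta_\lambda^2|v_\lambda|^2)^{1/2}$.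 For $(u,v)\in\ell_2(\Lambda,\mathbb{R}^M)\times\ell_{\infty,\rho^{-1}}(\Lambda)_+$ define, with values in $[0,\infty]$, $$\Phi^{(q)}(u,v)=\sum_{\lambda\in\Lambda}v_\lambda\|u_\lambda\|_q+\sum_{\lambda\in\Lambda}\omega_\lambda\|u_\lambda\|_2^2+\sum_{\lambda\in\Lambda}\theta_\lambda(\rho_\lambda-v_\lambda)^2,\qquad J(u,v)=\|Tu-g\|_{\mathcal{H}}^2+\Phi^{(q)}(u,v),$$ where $\|\cdot\|_q$ is the $\ell_q$-norm on $\mathbb{R}^M$. Strict convexity is understood on the set where the functional is finite. The iteration starts from some $v^{(0)}\in\ell_{\infty,\rho^{-1}}(\Lambda)_+$ for which $J(\cdot,v^{(0)})$ is not identically $+\infty$ (for example $v^{(0)}=(\rho_\lambda)_\lambda$), and $n=1,2,\dots$. *)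

theory Defs
  imports "HOL-Analysis.Analysis"
begin

(* Separable real Hilbert spaces are types of sort {real_inner, polish_space}: complete, and
   second countable, which for metric spaces is the same as separable. The index set Lambda is
   a type of class countable, R^M is real ^ 'm. *)

definition is_frame :: "('i \<Rightarrow> 'k::real_inner) \<Rightarrow> bool" where
  "is_frame \<psi> \<longleftrightarrow> (\<exists>a>0. \<exists>b>0. \<forall>x.
     (\<lambda>i. (x \<bullet> \<psi> i)\<^sup>2) summable_on UNIV \<and>
     a * (norm x)\<^sup>2 \<le> (\<Sum>\<^sub>\<infinity>i. (x \<bullet> \<psi> i)\<^sup>2) \<and>
     (\<Sum>\<^sub>\<infinity>i. (x \<bullet> \<psi> i)\<^sup>2) \<le> b * (norm x)\<^sup>2)"

definition l2_space :: "('i \<Rightarrow> real ^ 'm) set" where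
  "l2_space = {u. (\<lambda>i. (norm (u i))\<^sup>2) summable_on UNIV}"

definition l2_norm :: "('i \<Rightarrow> real ^ 'm) \<Rightarrow> real" where
  "l2_norm u = sqrt (\<Sum>\<^sub>\<infinity>i. (norm (u i))\<^sup>2)"

definition l2_inner :: "('i \<Rightarrow> real ^ 'm) \<Rightarrow> ('i \<Rightarrow> real ^ 'm) \<Rightarrow> real" where
  "l2_inner u w = (\<Sum>\<^sub>\<infinity>i. u i \<bullet> w i)"

definition l2_weakly_tendsto :: "(nat \<Rightarrow> 'i \<Rightarrow> real ^ 'm) \<Rightarrow> ('i \<Rightarrow> real ^ 'm) \<Rightarrow> bool" where
  "l2_weakly_tendsto u x \<longleftrightarrow>
     (\<forall>w\<in>l2_space. (\<lambda>n. l2_inner (u n) w) \<longlonglongrightarrow> l2_inner x w)"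

definition weighted_l2_space :: "('i \<Rightarrow> real) \<Rightarrow> ('i \<Rightarrow> real) set" where
  "weighted_l2_space \<theta> = {v. (\<lambda>i. (\<theta> i)\<^sup>2 * \<bar>v i\<bar>\<^sup>2) summable_on UNIV}"

definition weighted_l2_norm :: "('i \<Rightarrow> real) \<Rightarrow> ('i \<Rightarrow> real) \<Rightarrow> real" where
  "weighted_l2_norm \<theta> v = sqrt (\<Sum>\<^sub>\<infinity>i. (\<theta> i)\<^sup>2 * \<bar>v i\<bar>\<^sup>2)"

(* The cone of non-negative sequences in the weighted space l_{infinity, 1/rho}. *)
definition linf_cone :: "('i \<Rightarrow> real) \<Rightarrow> ('i \<Rightarrow> real) set" where
  "linf_cone \<rho> = {v. (\<forall>i. 0 \<le> v i) \<and> bdd_above (range (\<lambda>i. v i / \<rho> i))}"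

(* The l_q norm on R^M, for 1 <= q <= infinity. *)
definition lq_norm :: "ennreal \<Rightarrow> real ^ 'm \<Rightarrow> real" where
  "lq_norm q x =
     (if q = \<infinity> then Max (range (\<lambda>l. \<bar>x $ l\<bar>))
      else (\<Sum>l\<in>UNIV. \<bar>x $ l\<bar> powr enn2real q) powr (1 / enn2real q))"

definition synthesis :: "('i \<Rightarrow> 'k::real_inner) \<Rightarrow> ('i \<Rightarrow> real) \<Rightarrow> 'k" where
  "synthesis \<psi> c = (\<Sum>\<^sub>\<infinity>i. c i *\<^sub>R \<psi> i)"

(* The norm of 'h ^ 'n is the Hilbert direct sum norm (sum_j |x_j|^2)^(1/2). *)
definition T_op ::
  "('m \<Rightarrow> 'n \<Rightarrow> 'k::real_inner \<Rightarrow> 'h::real_inner) \<Rightarrow> ('i \<Rightarrow> 'k)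
    \<Rightarrow> ('i \<Rightarrow> real ^ 'm) \<Rightarrow> 'h ^ 'n"
  where "T_op A \<psi> u = (\<chi> j. \<Sum>l\<in>UNIV. A l j (synthesis \<psi> (\<lambda>i. u i $ l)))"

(* Sums in ennreal always exist; ennreal truncates negative reals to 0, which is harmless as
   all terms are non-negative for v in the cone and positive weights. *)
definition Phi ::
  "ennreal \<Rightarrow> ('i \<Rightarrow> real) \<Rightarrow> ('i \<Rightarrow> real) \<Rightarrow> ('i \<Rightarrow> real) \<Rightarrow> ('i \<Rightarrow> real ^ 'm) \<Rightarrow> ('i \<Rightarrow> real) \<Rightarrow> ennreal"
  where "Phi q \<omega> \<theta> \<rho> u v =
    (\<Sum>\<^sub>\<infinity>i. ennreal (v i * lq_norm q (u i)))
    + (\<Sum>\<^sub>\<infinity>i. ennreal (\<omega> i * (norm (u i))\<^sup>2))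
    + (\<Sum>\<^sub>\<infinity>i. ennreal (\<theta> i * (\<rho> i - v i)\<^sup>2))"

definition J_fun ::
  "('m \<Rightarrow> 'n \<Rightarrow> 'k::real_inner \<Rightarrow> 'h::real_inner) \<Rightarrow> ('i \<Rightarrow> 'k) \<Rightarrow> 'h ^ 'n
    \<Rightarrow> ennreal \<Rightarrow> ('i \<Rightarrow> real) \<Rightarrow> ('i \<Rightarrow> real) \<Rightarrow> ('i \<Rightarrow> real)
    \<Rightarrow> ('i \<Rightarrow> real ^ 'm) \<Rightarrow> ('i \<Rightarrow> real) \<Rightarrow> ennreal"
  where "J_fun A \<psi> g q \<omega> \<theta> \<rho> u v =
    ennreal ((norm (T_op A \<psi> u - g))\<^sup>2) + Phi q \<omega> \<theta> \<rho> u v"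

(* Strict convexity on the part of U x V where f is finite. Function spaces carry no
   real_vector instance, so convex combinations are written out pointwise. *)
definition strictly_convex_where_finite ::
  "('i \<Rightarrow> 'b::real_vector) set \<Rightarrow> ('i \<Rightarrow> real) set \<Rightarrow> (('i \<Rightarrow> 'b) \<Rightarrow> ('i \<Rightarrow> real) \<Rightarrow> ennreal) \<Rightarrow> bool"
  where "strictly_convex_where_finite U V f \<longleftrightarrow>
    (\<forall>u\<in>U. \<forall>v\<in>V. \<forall>u'\<in>U. \<forall>v'\<in>V. \<forall>t. 0 < t \<longrightarrow> t < 1 \<longrightarrow>
       (u, v) \<noteq> (u', v') \<longrightarrow> f u v < \<infinity> \<longrightarrow> f u' v' < \<infinity> \<longrightarrow>
       f (\<lambda>i. t *\<^sub>R u i + (1 - t) *\<^sub>R u' i) (\<lambda>i. t * v i + (1 - t) * v' i)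
         < ennreal t * f u v + ennreal (1 - t) * f u' v')"

(* The constants phi_1 = M, phi_2 = 1, phi_infinity = sqrt M; only used for these q. *)
definition phi_const :: "ennreal \<Rightarrow> nat \<Rightarrow> real" where
  "phi_const q M = (if q = 1 then real M else if q = 2 then 1 else sqrt (real M))"

end

theory Submission
  imports Defs
begin

text \<open>
  Write \<open>E x y\<close> for the functional, \<open>N\<close> for the \<open>q\<close>-norm, and let \<open>V x\<close> be the minimizer of \<open>E x\<close>,
  which is explicit: \<open>V x i = max 0 (\<rho> i - N (x i) / (2 \<theta> i))\<close>. Minimality of \<open>E (\<cdot>) y\<close> at \<open>x\<close> is
  equivalent to a family of one-block inequalities \<open>stationary x y\<close>, and these give the growth
  estimate \<open>E z y \<ge> E x y + (\<Sum>i. \<omega> i |z i - x i|\<^sup>2)\<close>. Along the iteration \<open>E\<close> therefore decreases and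
  consecutive iterates approach each other in every block. The iterates are bounded, so by Tychonoff and metrizability
  some subsequence converges blockwise, and passing to the limit in the one-block inequalities shows
  that its limit \<open>x\<close> satisfies \<open>stationary x (V x)\<close>. Convexity of each block in \<open>(z, y)\<close>, inherited
  from \<open>\<Phi>\<close>, turns this into global minimality of \<open>(x, V x)\<close>; strict convexity gives uniqueness, hence
  convergence of the whole sequence.

  For the strong convergence one adds the one-block inequalities at \<open>u\<^sup>(\<^sup>n\<^sup>+\<^sup>1\<^sup>)\<close> and at the limit. Since
  \<open>V\<close> is Lipschitz with constant \<open>1 / (2 \<theta> i)\<close> in \<open>N (x i)\<close> and \<open>N z \<le> sqrt \<phi> |z|\<close>, the condition
  \<open>\<theta> i * \<omega> i \<ge> \<sigma> > \<phi> / 4\<close> makes the weighted squared distance to the limit contract geometrically.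
\<close>

section \<open>Square-summable families\<close>

text \<open>A finite value in \<open>ennreal\<close> bounds every finite partial sum, and
  nonnegative terms with bounded partial sums are summable. This turns \<open>Phi\<close> into a
  real sum wherever it is finite.\<close>

lemma ennreal_infsum:
  fixes f :: "'a \<Rightarrow> real"
  assumes nonneg: "\<And>i. 0 \<le> f i"
  shows "(\<Sum>\<^sub>\<infinity>i. ennreal (f i)) = (if f summable_on UNIV then ennreal (\<Sum>\<^sub>\<infinity>i. f i) else \<infinity>)"
proof -
  have S: "(\<Sum>\<^sub>\<infinity>i. ennreal (f i)) = (SUP F\<in>{F. finite F}. ennreal (sum f F))"
    by (subst nonneg_infsum_complete) (auto simp: sum_ennreal nonneg)
  show ?thesis
  proof (cases "f summable_on UNIV")
    case True
    then show ?thesis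
      using S infsum_nonneg_is_SUPREMUM_ennreal[OF True] nonneg by simp
  next
    case False
    have "(\<Sum>\<^sub>\<infinity>i. ennreal (f i)) = \<infinity>"
    proof (rule ccontr)
      assume "(\<Sum>\<^sub>\<infinity>i. ennreal (f i)) \<noteq> \<infinity>"
      then obtain r where r: "0 \<le> r" "(\<Sum>\<^sub>\<infinity>i. ennreal (f i)) = ennreal r"
        by (metis ennreal_cases infinity_ennreal_def)
      have "sum f F \<le> r" if "finite F" for F
      proof -
        have "ennreal (sum f F) \<le> ennreal r"
          unfolding r(2)[symmetric] S using that by (intro SUP_upper) auto
        then show ?thesis using r(1) by (simp add: ennreal_le_iff)
      qed
      then have "f summable_on UNIV"
        by (intro nonneg_bdd_above_summable_on bdd_aboveI2) (auto simp: nonneg)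
      with False show False by simp
    qed
    with False show ?thesis by simp
  qed
qed

lemma summable_on_bounded_sums:
  fixes f :: "'a \<Rightarrow> real"
  assumes "\<And>i. 0 \<le> f i" and "\<And>F. finite F \<Longrightarrow> sum f F \<le> B"
  shows "f summable_on UNIV" and "infsum f UNIV \<le> B"
proof -
  show S: "f summable_on UNIV"
    using assms by (intro nonneg_bdd_above_summable_on bdd_aboveI2) auto
  show "infsum f UNIV \<le> B"
    by (rule infsum_le_finite_sums[OF S]) (use assms in auto)
qed

lemma infsum_split:
  fixes f :: "'a \<Rightarrow> real"
  assumes "f summable_on UNIV" "finite F"
  shows "infsum f UNIV = sum f F + infsum f (- F)"
proof -
  have "infsum f (F \<union> - F) = infsum f F + infsum f (- F)"
    by (rule infsum_Un_disjoint) (use assms in \<open>auto intro: summable_on_subset\<close>)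
  then show ?thesis using assms by simp
qed

lemma summable_on_tail_small:
  fixes f :: "'a \<Rightarrow> real"
  assumes "f summable_on UNIV" "0 < e"
  obtains F where "finite F" "infsum f (- F) < e"
proof -
  obtain F where F: "finite F" "dist (sum f F) (infsum f UNIV) \<le> e/2"
    using infsum_finite_approximation[OF assms(1), of "e/2"] assms(2) by auto
  then have "infsum f (- F) < e"
    using infsum_split[OF assms(1) F(1)] assms(2) by (auto simp: dist_real_def)
  with F show thesis using that by blast
qed

section \<open>Compactness and convergence in each coordinate\<close>

lemma compact_PiE_cball:
  fixes r :: "'i::countable \<Rightarrow> real"
  shows "compact (PiE UNIV (\<lambda>i. cball (0::'b::euclidean_space) (r i)))"
  using compactin_PiE[of "\<lambda>i. euclidean :: 'b topology" "UNIV :: 'i set" "\<lambda>i. cball 0 (r i)"]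
  by (simp add: euclidean_product_topology)

lemma tendsto_componentwise:
  fixes f :: "'a \<Rightarrow> 'i \<Rightarrow> 'b::topological_space"
  shows "(f \<longlongrightarrow> l) F \<longleftrightarrow> (\<forall>i. ((\<lambda>a. f a i) \<longlongrightarrow> l i) F)"
  using limitin_componentwise[of "\<lambda>i. euclidean :: 'b topology" "UNIV :: 'i set" f l F]
  by (simp add: euclidean_product_topology)

text \<open>A product of closed balls is compact by Tychonoff; a countable index type makes the
  product topology first countable, so compactness yields convergent subsequences.\<close>

lemma bounded_sequence_pointwise_subseq:
  fixes x :: "nat \<Rightarrow> 'i::countable \<Rightarrow> 'b::euclidean_space"
  assumes "\<And>n i. norm (x n i) \<le> r i"
  obtains l s where "strict_mono s" "\<And>i. (\<lambda>k. x (s k) i) \<longlonglongrightarrow> l i"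
proof -
  have "seq_compact (PiE UNIV (\<lambda>i. cball (0::'b) (r i)))"
    by (rule compact_imp_seq_compact[OF compact_PiE_cball])
  moreover have "\<forall>n. x n \<in> PiE UNIV (\<lambda>i. cball 0 (r i))"
    using assms by auto
  ultimately obtain l s where "strict_mono (s :: nat \<Rightarrow> nat)" "(x \<circ> s) \<longlonglongrightarrow> l"
    by (meson seq_compactE)
  then show thesis using that by (auto simp: tendsto_componentwise o_def)
qed

text \<open>Otherwise infinitely many terms lie outside some open neighbourhood of \<open>l\<close>,
  and enumerating their indices gives a subsequence with no subsequence tending to
  \<open>l\<close>.\<close>

lemma tendsto_if_subsubseq:
  fixes x :: "nat \<Rightarrow> 'a::topological_space"
  assumes "\<And>r. strict_mono r \<Longrightarrow> \<exists>s::nat\<Rightarrow>nat. strict_mono s \<and> (\<lambda>k. x (r (s k))) \<longlonglongrightarrow> l"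
  shows "x \<longlonglongrightarrow> l"
proof (rule ccontr)
  assume "\<not> x \<longlonglongrightarrow> l"
  then obtain S where S: "open S" "l \<in> S" "\<not> (\<forall>\<^sub>F n in sequentially. x n \<in> S)"
    by (auto simp: tendsto_def)
  then have "infinite {n. x n \<notin> S}"
    by (simp add: eventually_cofinite[symmetric] cofinite_eq_sequentially)
  then obtain r :: "nat \<Rightarrow> nat" where r: "strict_mono r" "\<And>n. r n \<in> {n. x n \<notin> S}"
    using infinite_enumerate by blast
  obtain s :: "nat \<Rightarrow> nat" where "(\<lambda>k. x (r (s k))) \<longlonglongrightarrow> l"
    using assms[OF r(1)] by blast
  then have "\<forall>\<^sub>F k in sequentially. x (r (s k)) \<in> S"
    using S by (auto simp: tendsto_def)
  then show False using r(2) by (auto dest: eventually_happens)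
qed

section \<open>Square-summable families and weak limits\<close>

lemma norm_diff_power2_le: "(norm (a - b))\<^sup>2 \<le> 2 * (norm a)\<^sup>2 + 2 * (norm b)\<^sup>2"
  using sum_squares_bound[of "norm a" "norm b"] norm_triangle_ineq4[of a b]
    power_mono[of "norm (a - b)" "norm a + norm b" 2] by (simp add: power2_sum)

text \<open>Young's inequality with a free weight, from expanding a square. The weight is tuned in
  \<open>l2_weak_limit\<close> and is the frame bound in \<open>bessel_sum_bound\<close>.\<close>

lemma two_inner_le:
  fixes a b :: "'a::real_inner"
  assumes "0 < \<delta>"
  shows "2 * \<bar>a \<bullet> b\<bar> \<le> \<delta> * (norm a)\<^sup>2 + (norm b)\<^sup>2 / \<delta>"
proof -
  have "0 \<le> (sqrt \<delta> * norm a - norm b / sqrt \<delta>)\<^sup>2" by simp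
  also have "\<dots> = \<delta> * (norm a)\<^sup>2 + (norm b)\<^sup>2 / \<delta> - 2 * (norm a * norm b)"
    using assms by (simp add: power2_diff power_mult_distrib power_divide)
  finally show ?thesis using Cauchy_Schwarz_ineq2[of a b] by simp
qed

lemma l2_inner_summable:
  assumes "x \<in> l2_space" "y \<in> l2_space"
  shows "(\<lambda>i. x i \<bullet> y i) summable_on UNIV"
proof -
  have "(\<lambda>i. (norm (x i))\<^sup>2 + (norm (y i))\<^sup>2) summable_on UNIV"
    using assms by (intro summable_on_add) (auto simp: l2_space_def)
  then have "(\<lambda>i. norm (x i \<bullet> y i)) summable_on UNIV"
  proof (rule summable_on_comparison_test)
    fix i show "norm (x i \<bullet> y i) \<le> (norm (x i))\<^sup>2 + (norm (y i))\<^sup>2"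
      using two_inner_le[of 1 "x i" "y i"] by simp
  qed simp
  then show ?thesis by (rule abs_summable_summable)
qed

lemma l2_diff:
  assumes "x \<in> l2_space" "y \<in> l2_space"
  shows "(\<lambda>i. x i - y i) \<in> l2_space"
proof -
  have "(\<lambda>i. 2 * (norm (x i))\<^sup>2 + 2 * (norm (y i))\<^sup>2) summable_on UNIV"
    using assms by (intro summable_on_add summable_on_cmult_right) (auto simp: l2_space_def)
  then have "(\<lambda>i. (norm (x i - y i))\<^sup>2) summable_on UNIV"
    by (rule summable_on_comparison_test) (auto intro: norm_diff_power2_le)
  then show ?thesis by (simp add: l2_space_def)
qed

lemma l2_fun_upd:
  assumes "x \<in> l2_space"
  shows "x(i := z) \<in> l2_space"
proof -
  have "(\<lambda>j. (norm (x j))\<^sup>2) summable_on (UNIV - {i})"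
    using assms by (auto simp: l2_space_def intro: summable_on_subset)
  then have "(\<lambda>j. (norm ((x(i := z)) j))\<^sup>2) summable_on (UNIV - {i})"
    by (subst summable_on_cong[of _ _ "\<lambda>j. (norm (x j))\<^sup>2"]) auto
  then have "(\<lambda>j. (norm ((x(i := z)) j))\<^sup>2) summable_on ((UNIV - {i}) \<union> {i})"
    by (intro summable_on_Un_disjoint) auto
  then show ?thesis by (simp add: l2_space_def insert_absorb)
qed

text \<open>A Fatou argument: the bound passes to the limit on each finite set of indices, and
  finite sums control the infinite one.\<close>

lemma l2_pointwise_limit:
  assumes lim: "\<And>i. (\<lambda>n. x n i) \<longlonglongrightarrow> l i"
    and l2: "\<And>n. x n \<in> l2_space"
    and bd: "\<And>n. (\<Sum>\<^sub>\<infinity>i. (norm (x n i))\<^sup>2) \<le> B"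
  shows "l \<in> l2_space" and "(\<Sum>\<^sub>\<infinity>i. (norm (l i))\<^sup>2) \<le> B"
proof -
  have *: "(\<Sum>i\<in>F. (norm (l i))\<^sup>2) \<le> B" if "finite F" for F
  proof (rule tendsto_upperbound)
    show "(\<lambda>n. \<Sum>i\<in>F. (norm (x n i))\<^sup>2) \<longlonglongrightarrow> (\<Sum>i\<in>F. (norm (l i))\<^sup>2)"
      by (intro tendsto_intros lim)
    show "\<forall>\<^sub>F n in sequentially. (\<Sum>i\<in>F. (norm (x n i))\<^sup>2) \<le> B"
    proof (rule always_eventually, rule)
      fix n
      have "(\<Sum>i\<in>F. (norm (x n i))\<^sup>2) \<le> (\<Sum>\<^sub>\<infinity>i. (norm (x n i))\<^sup>2)"
        using l2 that by (intro finite_sum_le_infsum) (auto simp: l2_space_def)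
      then show "(\<Sum>i\<in>F. (norm (x n i))\<^sup>2) \<le> B" using bd[of n] by simp
    qed
  qed simp
  show "l \<in> l2_space" "(\<Sum>\<^sub>\<infinity>i. (norm (l i))\<^sup>2) \<le> B"
    using summable_on_bounded_sums[of "\<lambda>i. (norm (l i))\<^sup>2" B, OF _ *] by (auto simp: l2_space_def)
qed

text \<open>Coordinatewise convergence with bounded norms is weak convergence: a finite set carries
  almost all the mass of \<open>w\<close>, where coordinatewise limits suffice, and Young's
  inequality controls the rest.\<close>

lemma l2_weak_limit:
  fixes x :: "nat \<Rightarrow> 'i \<Rightarrow> real^'m"
  assumes lim: "\<And>i. (\<lambda>n. x n i) \<longlonglongrightarrow> l i"
    and l2: "\<And>n. x n \<in> l2_space"
    and bd: "\<And>n. (\<Sum>\<^sub>\<infinity>i. (norm (x n i))\<^sup>2) \<le> B"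
    and w: "w \<in> l2_space"
  shows "(\<lambda>n. \<Sum>\<^sub>\<infinity>i. w i \<bullet> x n i) \<longlonglongrightarrow> (\<Sum>\<^sub>\<infinity>i. w i \<bullet> l i)"
proof -
  note l = l2_pointwise_limit[OF lim l2 bd]
  define d where "d = (\<lambda>n i. x n i - l i)"
  have d: "d n \<in> l2_space" for n
    unfolding d_def by (rule l2_diff[OF l2 l(1)])
  have sq: "(norm (d n i))\<^sup>2 \<le> 2 * (norm (x n i))\<^sup>2 + 2 * (norm (l i))\<^sup>2" for n i
    unfolding d_def by (rule norm_diff_power2_le)
  have B: "0 \<le> B" using bd[of 0] infsum_nonneg[of UNIV "\<lambda>i. (norm (x 0 i))\<^sup>2"] by simp
  have dB: "(\<Sum>\<^sub>\<infinity>i. (norm (d n i))\<^sup>2) \<le> 4 * B" for n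
  proof -
    have "(\<Sum>\<^sub>\<infinity>i. (norm (d n i))\<^sup>2) \<le> (\<Sum>\<^sub>\<infinity>i. 2 * (norm (x n i))\<^sup>2 + 2 * (norm (l i))\<^sup>2)"
      using l2[of n] l(1) d[of n]
      by (intro infsum_mono sq summable_on_add summable_on_cmult_right) (auto simp: l2_space_def)
    also have "\<dots> = 2 * (\<Sum>\<^sub>\<infinity>i. (norm (x n i))\<^sup>2) + 2 * (\<Sum>\<^sub>\<infinity>i. (norm (l i))\<^sup>2)"
      using l2[of n] l(1)
      by (subst infsum_add) (auto simp: l2_space_def infsum_cmult_right' intro: summable_on_cmult_right)
    finally show ?thesis using bd[of n] l(2) by simp
  qed
  have "(\<lambda>n. \<Sum>\<^sub>\<infinity>i. w i \<bullet> d n i) \<longlonglongrightarrow> 0"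
  proof (rule LIMSEQ_I)
    fix e :: real assume e: "0 < e"
    \<comment> \<open>The \<open>+ 1\<close> covers \<open>B = 0\<close>. Twice the tail is below
      \<open>\<delta> * (4 * B) + e/2\<close>, hence below \<open>3*e/2\<close>; the finite part
      takes the remaining \<open>e/4\<close>.\<close>
    define \<delta> where "\<delta> = e / (4 * B + 1)"
    have \<delta>: "0 < \<delta>" "\<delta> * (4 * B) \<le> e"
      using e B by (auto simp: \<delta>_def field_simps add_pos_nonneg)
    have sw: "(\<lambda>i. (norm (w i))\<^sup>2) summable_on UNIV" using w by (simp add: l2_space_def)
    obtain F where F: "finite F" "(\<Sum>\<^sub>\<infinity>i\<in>-F. (norm (w i))\<^sup>2) < \<delta> * (e/2)"
      using summable_on_tail_small[OF sw, of "\<delta> * (e/2)"] \<delta> e by auto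
    have "(\<lambda>n. \<Sum>i\<in>F. w i \<bullet> d n i) \<longlonglongrightarrow> (\<Sum>i\<in>F. w i \<bullet> (l i - l i))"
      unfolding d_def by (intro tendsto_intros lim)
    then have "(\<lambda>n. \<Sum>i\<in>F. w i \<bullet> d n i) \<longlonglongrightarrow> 0" by simp
    from LIMSEQ_D[OF this, of "e/4"] e obtain n0
      where n0: "\<And>n. n \<ge> n0 \<Longrightarrow> \<bar>\<Sum>i\<in>F. w i \<bullet> d n i\<bar> < e/4" by auto
    have tail: "\<bar>\<Sum>\<^sub>\<infinity>i\<in>-F. w i \<bullet> d n i\<bar> < 3*e/4" for n
    proof -
      have sd: "(\<lambda>i. (norm (d n i))\<^sup>2) summable_on UNIV" using d by (simp add: l2_space_def)
      have sdF: "(\<lambda>i. (norm (d n i))\<^sup>2) summable_on -F" and swF: "(\<lambda>i. (norm (w i))\<^sup>2) summable_on -F"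
        using sd sw by (auto intro: summable_on_subset)
      have sb: "(\<lambda>i. \<delta> * (norm (d n i))\<^sup>2 + (norm (w i))\<^sup>2 / \<delta>) summable_on -F"
        using sdF swF by (intro summable_on_add summable_on_cmult_right)
          (auto simp: divide_inverse intro: summable_on_cmult_left)
      have le: "2 * \<bar>w i \<bullet> d n i\<bar> \<le> \<delta> * (norm (d n i))\<^sup>2 + (norm (w i))\<^sup>2 / \<delta>" for i
        using two_inner_le[OF \<delta>(1), of "d n i" "w i"] by (simp add: inner_commute)
      have sab: "(\<lambda>i. 2 * \<bar>w i \<bullet> d n i\<bar>) summable_on -F"
        by (rule summable_on_comparison_test[OF sb]) (use le in auto)
      have "(\<lambda>i. norm (w i \<bullet> d n i)) summable_on -F"
        using summable_on_cmult_right[OF sab, of "1/2"] by simp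
      then have "2 * \<bar>\<Sum>\<^sub>\<infinity>i\<in>-F. w i \<bullet> d n i\<bar> \<le> 2 * (\<Sum>\<^sub>\<infinity>i\<in>-F. \<bar>w i \<bullet> d n i\<bar>)"
        using norm_infsum_bound[of "\<lambda>i. w i \<bullet> d n i" "-F"] by simp
      also have "\<dots> = (\<Sum>\<^sub>\<infinity>i\<in>-F. 2 * \<bar>w i \<bullet> d n i\<bar>)" by (simp add: infsum_cmult_right')
      also have "\<dots> \<le> (\<Sum>\<^sub>\<infinity>i\<in>-F. \<delta> * (norm (d n i))\<^sup>2 + (norm (w i))\<^sup>2 / \<delta>)"
        by (rule infsum_mono[OF sab sb]) (rule le)
      also have "\<dots> = \<delta> * (\<Sum>\<^sub>\<infinity>i\<in>-F. (norm (d n i))\<^sup>2) + (\<Sum>\<^sub>\<infinity>i\<in>-F. (norm (w i))\<^sup>2) / \<delta>"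
        using sdF swF
        by (subst infsum_add) (auto simp: divide_inverse infsum_cmult_right' infsum_cmult_left'
            intro: summable_on_cmult_right summable_on_cmult_left)
      also have "\<dots> < \<delta> * (4 * B) + e/2"
      proof (rule add_le_less_mono)
        have "(\<Sum>\<^sub>\<infinity>i\<in>-F. (norm (d n i))\<^sup>2) \<le> (\<Sum>\<^sub>\<infinity>i. (norm (d n i))\<^sup>2)"
          by (rule infsum_mono2[OF sdF sd]) auto
        also note dB
        finally show "\<delta> * (\<Sum>\<^sub>\<infinity>i\<in>-F. (norm (d n i))\<^sup>2) \<le> \<delta> * (4 * B)"
          using \<delta> by (intro mult_left_mono) auto
        show "(\<Sum>\<^sub>\<infinity>i\<in>-F. (norm (w i))\<^sup>2) / \<delta> < e/2"
          using F(2) \<delta>(1) by (simp add: divide_less_eq mult.commute)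
      qed
      finally show ?thesis using \<delta>(2) by simp
    qed
    have "norm ((\<Sum>\<^sub>\<infinity>i. w i \<bullet> d n i) - 0) < e" if "n \<ge> n0" for n
      using infsum_split[OF l2_inner_summable[OF w d[of n]] F(1)] n0[OF that] tail[of n] by simp
    then show "\<exists>no. \<forall>n\<ge>no. norm ((\<Sum>\<^sub>\<infinity>i. w i \<bullet> d n i) - 0) < e" by blast
  qed
  moreover have "(\<Sum>\<^sub>\<infinity>i. w i \<bullet> d n i) = (\<Sum>\<^sub>\<infinity>i. w i \<bullet> x n i) - (\<Sum>\<^sub>\<infinity>i. w i \<bullet> l i)" for n
  proof -
    have "(\<Sum>\<^sub>\<infinity>i. w i \<bullet> x n i) = (\<Sum>\<^sub>\<infinity>i. w i \<bullet> d n i + w i \<bullet> l i)"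
      by (simp add: d_def inner_diff_right)
    also have "\<dots> = (\<Sum>\<^sub>\<infinity>i. w i \<bullet> d n i) + (\<Sum>\<^sub>\<infinity>i. w i \<bullet> l i)"
      using w d l by (intro infsum_add l2_inner_summable)
    finally show ?thesis by simp
  qed
  ultimately show ?thesis using LIM_zero_iff by force
qed

section \<open>The norms on the fibres and the operator\<close>

text \<open>For positive arguments this is convexity of the power; if one of them is 0, it reduces
  to \<open>s powr p <= s\<close> for \<open>s\<close> in the unit interval.\<close>

lemma powr_convex_combination:
  fixes x y p :: real
  assumes "1 \<le> p" "0 \<le> x" "0 \<le> y" "0 \<le> t" "t \<le> 1"
  shows "(t * x + (1 - t) * y) powr p \<le> t * x powr p + (1 - t) * y powr p"
proof -
  have scale: "(s * z) powr p \<le> s * z powr p" if "0 \<le> s" "s \<le> 1" "0 \<le> z" for s z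
  proof (cases "s = 0")
    case False
    then have "s powr p \<le> s powr 1"
      using that assms(1) by (intro powr_mono') auto
    then show ?thesis
      using that False by (simp add: powr_mult mult_right_mono)
  qed simp
  consider "x = 0" | "y = 0" | "0 < x" "0 < y" using assms by linarith
  then show ?thesis
  proof cases
    case 1 then show ?thesis using scale[of "1 - t" y] assms by simp
  next
    case 2 then show ?thesis using scale[of t x] assms by simp
  next
    case 3
    then show ?thesis
      using convex_onD[OF powr_convex[OF assms(1)], of t y x] assms by (simp add: add.commute)
  qed
qed

lemma enn2real_ge_1: "1 \<le> q \<Longrightarrow> q \<noteq> \<infinity> \<Longrightarrow> 1 \<le> enn2real q"
  using enn2real_mono[of 1 q] by (simp add: top.not_eq_extremum)

lemma lq_norm_scale:
  fixes x :: "real^'m"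
  assumes "1 \<le> q"
  shows "lq_norm q (c *\<^sub>R x) = \<bar>c\<bar> * lq_norm q x"
proof (cases "q = \<infinity>")
  case True
  have "Max ((*) \<bar>c\<bar> ` range (\<lambda>l. \<bar>x $ l\<bar>)) = \<bar>c\<bar> * Max (range (\<lambda>l. \<bar>x $ l\<bar>))"
    by (rule mono_Max_commute[symmetric]) (auto simp: mono_def mult_left_mono)
  then show ?thesis
    using True by (simp add: lq_norm_def abs_mult image_image)
next
  case False
  define p where "p = enn2real q"
  have p: "1 \<le> p" unfolding p_def by (rule enn2real_ge_1[OF assms False])
  have "(\<Sum>l\<in>UNIV. \<bar>(c *\<^sub>R x) $ l\<bar> powr p) = \<bar>c\<bar> powr p * (\<Sum>l\<in>UNIV. \<bar>x $ l\<bar> powr p)"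
    by (simp add: abs_mult powr_mult sum_distrib_left)
  then show ?thesis
    using False p by (simp add: lq_norm_def p_def[symmetric] powr_mult powr_powr sum_nonneg)
qed

lemma lq_norm_nonneg: "0 \<le> lq_norm q (x :: real^'m)"
proof (cases "q = \<infinity>")
  case True
  have "\<bar>x $ undefined\<bar> \<le> Max (range (\<lambda>l. \<bar>x $ l\<bar>))" by (intro Max_ge) auto
  then have "0 \<le> Max (range (\<lambda>l. \<bar>x $ l\<bar>))" by (rule order_trans[OF abs_ge_zero])
  then show ?thesis using True by (simp add: lq_norm_def)
qed (simp add: lq_norm_def)

lemma lq_norm_eq_0:
  fixes x :: "real^'m"
  assumes "1 \<le> q" "lq_norm q x = 0"
  shows "x = 0"
proof (cases "q = \<infinity>")
  case True
  have "\<bar>x $ l\<bar> \<le> 0" for l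
  proof -
    have "\<bar>x $ l\<bar> \<le> Max (range (\<lambda>l. \<bar>x $ l\<bar>))" by (intro Max_ge) auto
    also have "\<dots> = 0" using True assms by (simp add: lq_norm_def)
    finally show ?thesis .
  qed
  then show ?thesis by (simp add: vec_eq_iff)
next
  case False
  then have "(\<Sum>l\<in>UNIV. \<bar>x $ l\<bar> powr enn2real q) = 0"
    using assms by (simp add: lq_norm_def)
  then show ?thesis by (simp add: sum_nonneg_eq_0_iff vec_eq_iff)
qed

text \<open>Minkowski's inequality, obtained from convexity of the power after normalising both
  vectors.\<close>

lemma lq_norm_triangle:
  fixes x y :: "real^'m"
  assumes "1 \<le> q"
  shows "lq_norm q (x + y) \<le> lq_norm q x + lq_norm q y"
proof (cases "q = \<infinity>")
  case True
  have M: "\<bar>z $ l\<bar> \<le> Max (range (\<lambda>l. \<bar>z $ l\<bar>))" for l and z :: "real^'m" by (intro Max_ge) auto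
  have "\<bar>x $ l + y $ l\<bar> \<le> Max (range (\<lambda>l. \<bar>x $ l\<bar>)) + Max (range (\<lambda>l. \<bar>y $ l\<bar>))" for l
    using M[of x l] M[of y l] by linarith
  then have "Max (range (\<lambda>l. \<bar>(x + y) $ l\<bar>)) \<le> Max (range (\<lambda>l. \<bar>x $ l\<bar>)) + Max (range (\<lambda>l. \<bar>y $ l\<bar>))"
    by (intro Max.boundedI) auto
  then show ?thesis using True by (simp add: lq_norm_def)
next
  case False
  define p where "p = enn2real q"
  have p: "1 \<le> p" unfolding p_def by (rule enn2real_ge_1[OF assms False])
  have N: "lq_norm q z = (\<Sum>l\<in>UNIV. \<bar>z $ l\<bar> powr p) powr (1 / p)" for z :: "real^'m"
    using False by (simp add: lq_norm_def p_def)
  define a where "a = lq_norm q x"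
  define b where "b = lq_norm q y"
  show ?thesis
  proof (cases "a = 0 \<or> b = 0")
    case True
    then have "x = 0 \<or> y = 0" using lq_norm_eq_0[OF assms] by (auto simp: a_def b_def)
    then show ?thesis using lq_norm_nonneg[of q] by auto
  next
    case ab: False
    then have pos: "0 < a" "0 < b"
      using lq_norm_nonneg[of q x] lq_norm_nonneg[of q y] by (auto simp: a_def b_def)
    have sx: "(\<Sum>l\<in>UNIV. \<bar>x $ l\<bar> powr p) = a powr p" and sy: "(\<Sum>l\<in>UNIV. \<bar>y $ l\<bar> powr p) = b powr p"
      using p by (auto simp: a_def b_def N powr_powr sum_nonneg)
    \<comment> \<open>With this weight \<open>(x + y) / (a + b)\<close> is a convex combination of
      the normalised vectors \<open>x / a\<close> and \<open>y / b\<close>, so the sum of its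
      \<open>p\<close>-th powers is at most 1.\<close>
    define t where "t = a / (a + b)"
    have t: "0 \<le> t" "t \<le> 1" and t1: "1 - t = b / (a + b)" using pos by (auto simp: t_def field_simps)
    have "(\<Sum>l\<in>UNIV. (\<bar>(x + y) $ l\<bar> / (a + b)) powr p)
        \<le> (\<Sum>l\<in>UNIV. t * (\<bar>x $ l\<bar> / a) powr p + (1 - t) * (\<bar>y $ l\<bar> / b) powr p)"
    proof (rule sum_mono)
      fix l
      have "(\<bar>(x + y) $ l\<bar> / (a + b)) powr p \<le> (t * (\<bar>x $ l\<bar> / a) + (1 - t) * (\<bar>y $ l\<bar> / b)) powr p"
      proof (rule powr_mono2)
        have "t * (\<bar>x $ l\<bar> / a) + (1 - t) * (\<bar>y $ l\<bar> / b) = (\<bar>x $ l\<bar> + \<bar>y $ l\<bar>) / (a + b)"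
          unfolding t1 using pos by (simp add: t_def add_divide_distrib)
        then show "\<bar>(x + y) $ l\<bar> / (a + b) \<le> t * (\<bar>x $ l\<bar> / a) + (1 - t) * (\<bar>y $ l\<bar> / b)"
          using pos by (simp add: divide_right_mono)
      qed (use p pos in auto)
      also have "\<dots> \<le> t * (\<bar>x $ l\<bar> / a) powr p + (1 - t) * (\<bar>y $ l\<bar> / b) powr p"
        using p t pos by (intro powr_convex_combination) auto
      finally show "(\<bar>(x + y) $ l\<bar> / (a + b)) powr p
        \<le> t * (\<bar>x $ l\<bar> / a) powr p + (1 - t) * (\<bar>y $ l\<bar> / b) powr p" .
    qed
    also have "\<dots> = 1"
      using pos by (simp add: sum.distrib sum_distrib_left[symmetric] powr_divide
          sum_divide_distrib[symmetric] sx sy)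
    finally have "(\<Sum>l\<in>UNIV. \<bar>(x + y) $ l\<bar> powr p) / (a + b) powr p \<le> 1"
      using pos by (simp add: powr_divide sum_divide_distrib[symmetric])
    then have "(\<Sum>l\<in>UNIV. \<bar>(x + y) $ l\<bar> powr p) \<le> (a + b) powr p"
      using pos by (simp add: divide_le_eq)
    then have "lq_norm q (x + y) \<le> ((a + b) powr p) powr (1 / p)"
      unfolding N using p by (intro powr_mono2) (auto intro: sum_nonneg)
    also have "\<dots> = a + b" using p pos by (simp add: powr_powr)
    finally show ?thesis by (simp add: a_def b_def)
  qed
qed

lemma lq_norm_1: "lq_norm 1 (x :: real^'m) = (\<Sum>l\<in>UNIV. \<bar>x $ l\<bar>)"
  by (simp add: lq_norm_def sum_nonneg)

lemma lq_norm_2: "lq_norm 2 (x :: real^'m) = norm x"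
proof -
  have "lq_norm 2 x = (\<Sum>l\<in>UNIV. \<bar>x $ l\<bar> powr 2) powr (1/2)"
    by (simp add: lq_norm_def)
  also have "\<dots> = sqrt (\<Sum>l\<in>UNIV. (\<bar>x $ l\<bar>)\<^sup>2)"
    by (simp add: powr_half_sqrt sum_nonneg)
  finally show ?thesis by (simp add: norm_vec_def L2_set_def)
qed

text \<open>For \<open>q = 1\<close> this is Cauchy-Schwarz against the all-ones vector, for
  \<open>q = 2\<close> an equality; for \<open>q = \<infinity>\<close> the bound holds with constant
  1, and \<open>sqrt (phi_const q CARD('m))\<close> is at least 1.\<close>

lemma lq_norm_le_phi_const:
  fixes x :: "real^'m"
  assumes "q \<in> {1, 2, \<infinity>}"
  shows "lq_norm q x \<le> sqrt (phi_const q CARD('m)) * norm x"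
proof -
  consider "q = 1" | "q = 2" | "q = \<infinity>" using assms by blast
  then show ?thesis
  proof cases
    case 1
    have "(\<Sum>l\<in>UNIV. \<bar>x $ l\<bar>) = (\<Sum>l\<in>UNIV. \<bar>1::real\<bar> * \<bar>x $ l\<bar>)" by simp
    also have "\<dots> \<le> L2_set (\<lambda>_. 1) (UNIV :: 'm set) * L2_set (\<lambda>l. x $ l) UNIV"
      by (rule L2_set_mult_ineq)
    also have "L2_set (\<lambda>l. x $ l) UNIV = norm x" by (simp add: norm_vec_def L2_set_def)
    also have "L2_set (\<lambda>_. 1) (UNIV :: 'm set) = sqrt (real CARD('m))" by (simp add: L2_set_def)
    finally show ?thesis using 1 by (simp add: lq_norm_1 phi_const_def)
  next
    case 2
    then show ?thesis by (simp add: lq_norm_2 phi_const_def)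
  next
    case 3
    have c: "1 \<le> sqrt (phi_const q CARD('m))"
      using 3 by (simp add: phi_const_def Suc_le_eq)
    have "lq_norm q x \<le> norm x"
      using 3 by (auto simp: lq_norm_def intro!: Max.boundedI component_le_norm_cart)
    also have "\<dots> \<le> sqrt (phi_const q CARD('m)) * norm x"
      using mult_right_mono[OF c norm_ge_zero[of x]] by simp
    finally show ?thesis .
  qed
qed

section \<open>Frame synthesis and the adjoint of \<open>T\<close>\<close>

text \<open>Two finite sets containing \<open>F\<close> differ from it by sets disjoint from
  \<open>F\<close>, so their partial sums are close; the filter of partial sums is Cauchy and
  completeness gives the limit.\<close>

lemma summable_on_Cauchy_sums:
  fixes f :: "'a \<Rightarrow> 'b::{real_normed_vector, complete_space}"
  assumes "\<And>e. 0 < e \<Longrightarrow> \<exists>F. finite F \<and> (\<forall>G. finite G \<longrightarrow> G \<inter> F = {} \<longrightarrow> norm (sum f G) < e)"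
  shows "f summable_on UNIV"
proof -
  have "\<exists>P. eventually P (finite_subsets_at_top UNIV) \<and>
              (\<forall>F F'. P F \<and> P F' \<longrightarrow> dist (sum f F) (sum f F') < e)" if e: "0 < e" for e
  proof -
    obtain F0 where F0: "finite F0" "\<And>G. finite G \<Longrightarrow> G \<inter> F0 = {} \<Longrightarrow> norm (sum f G) < e/2"
      using assms[of "e/2"] e by auto
    have "dist (sum f F) (sum f F0) < e/2" if "finite F" "F0 \<subseteq> F" for F
      using F0(2)[of "F - F0"] that by (auto simp: dist_norm sum_diff)
    then have "\<forall>F F'. (finite F \<and> F0 \<subseteq> F) \<and> (finite F' \<and> F0 \<subseteq> F') \<longrightarrow> dist (sum f F) (sum f F') < e"
      by (metis dist_triangle_half_l)
    moreover have "eventually (\<lambda>F. finite F \<and> F0 \<subseteq> F) (finite_subsets_at_top UNIV)"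
      using F0(1) by (auto simp: eventually_finite_subsets_at_top)
    ultimately show ?thesis by blast
  qed
  then have "cauchy_filter (filtermap (sum f) (finite_subsets_at_top UNIV))"
    by (simp add: cauchy_filter_metric_filtermap)
  moreover have "complete (UNIV :: 'b set)"
    by (meson Cauchy_convergent UNIV_I complete_def convergent_def)
  ultimately obtain L where "(sum f \<longlongrightarrow> L) (finite_subsets_at_top UNIV)"
    using complete_uniform[where S="UNIV :: 'b set"] by (force simp add: filterlim_def)
  then show ?thesis using summable_on_def has_sum_def by blast
qed

text \<open>Duality: the squared norm of the sum \<open>s\<close> equals the sum of
  \<open>c i * (s \<bullet> \<psi> i)\<close>. Young's inequality with weight \<open>b\<close> and
  the upper frame bound return one copy of it, which is absorbed on the left.\<close>

lemma bessel_sum_bound: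
  fixes \<psi> :: "'i \<Rightarrow> 'k::real_inner"
  assumes b: "0 < b" "\<And>x. (\<lambda>i. (x \<bullet> \<psi> i)\<^sup>2) summable_on UNIV" "\<And>x. (\<Sum>\<^sub>\<infinity>i. (x \<bullet> \<psi> i)\<^sup>2) \<le> b * (norm x)\<^sup>2"
    and F: "finite F"
  shows "(norm (\<Sum>i\<in>F. c i *\<^sub>R \<psi> i))\<^sup>2 \<le> b * (\<Sum>i\<in>F. (c i)\<^sup>2)"
proof -
  define s where "s = (\<Sum>i\<in>F. c i *\<^sub>R \<psi> i)"
  have "2 * (norm s)\<^sup>2 = (\<Sum>i\<in>F. 2 * (c i * (s \<bullet> \<psi> i)))"
    unfolding power2_norm_eq_inner
    by (subst (2) s_def) (simp add: inner_sum_right sum_distrib_left)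
  also have "\<dots> \<le> (\<Sum>i\<in>F. b * (c i)\<^sup>2 + (s \<bullet> \<psi> i)\<^sup>2 / b)"
  proof (rule sum_mono)
    fix i
    have "2 * \<bar>c i \<bullet> (s \<bullet> \<psi> i)\<bar> \<le> b * (norm (c i))\<^sup>2 + (norm (s \<bullet> \<psi> i))\<^sup>2 / b"
      by (rule two_inner_le[OF b(1)])
    then show "2 * (c i * (s \<bullet> \<psi> i)) \<le> b * (c i)\<^sup>2 + (s \<bullet> \<psi> i)\<^sup>2 / b"
      by simp
  qed
  also have "\<dots> = b * (\<Sum>i\<in>F. (c i)\<^sup>2) + (\<Sum>i\<in>F. (s \<bullet> \<psi> i)\<^sup>2) / b"
    by (simp add: sum.distrib sum_distrib_left sum_divide_distrib)
  also have "(\<Sum>i\<in>F. (s \<bullet> \<psi> i)\<^sup>2) \<le> b * (norm s)\<^sup>2"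
    using finite_sum_le_infsum[OF b(2) F, of s] b(3)[of s] by simp
  finally show ?thesis using b(1) by (simp add: divide_right_mono field_simps s_def)
qed

text \<open>Tails of the series are controlled by tails of the squared coefficients. Since
  \<open>infsum\<close> is 0 by default, summability is what makes \<open>synthesis\<close> the true
  series.\<close>

lemma frame_synthesis_has_sum:
  fixes \<psi> :: "'i \<Rightarrow> 'k::{real_inner, complete_space}"
  assumes "is_frame \<psi>" "(\<lambda>i. (c i)\<^sup>2) summable_on UNIV"
  shows "((\<lambda>i. c i *\<^sub>R \<psi> i) has_sum synthesis \<psi> c) UNIV"
proof -
  obtain b where b: "0 < b" "\<And>x. (\<lambda>i. (x \<bullet> \<psi> i)\<^sup>2) summable_on UNIV"
      "\<And>x. (\<Sum>\<^sub>\<infinity>i. (x \<bullet> \<psi> i)\<^sup>2) \<le> b * (norm x)\<^sup>2"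
    using assms(1) unfolding is_frame_def by blast
  have "(\<lambda>i. c i *\<^sub>R \<psi> i) summable_on UNIV"
  proof (rule summable_on_Cauchy_sums)
    fix e :: real assume e: "0 < e"
    obtain F where F: "finite F" "infsum (\<lambda>i. (c i)\<^sup>2) (- F) < e\<^sup>2 / b"
      using summable_on_tail_small[OF assms(2), of "e\<^sup>2 / b"] e b(1) by auto
    have "norm (\<Sum>i\<in>G. c i *\<^sub>R \<psi> i) < e" if G: "finite G" "G \<inter> F = {}" for G
    proof -
      have "(\<Sum>i\<in>G. (c i)\<^sup>2) \<le> infsum (\<lambda>i. (c i)\<^sup>2) (- F)"
        using G assms(2) by (intro finite_sum_le_infsum) (auto intro: summable_on_subset)
      then have "b * (\<Sum>i\<in>G. (c i)\<^sup>2) < e\<^sup>2"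
        using F(2) b(1) by (simp add: field_simps)
          (smt (verit, best) mult_right_mono mult.commute)
      then have "(norm (\<Sum>i\<in>G. c i *\<^sub>R \<psi> i))\<^sup>2 < e\<^sup>2"
        using bessel_sum_bound[OF b G(1), of c] by linarith
      then show ?thesis using e by (simp add: power_less_imp_less_base)
    qed
    with F(1) show "\<exists>F. finite F \<and> (\<forall>G. finite G \<longrightarrow> G \<inter> F = {} \<longrightarrow> norm (\<Sum>i\<in>G. c i *\<^sub>R \<psi> i) < e)"
      by blast
  qed
  then show ?thesis by (simp add: synthesis_def)
qed

text \<open>Taking the values \<open>f (\<psi> i)\<close> themselves as coefficients, a finite
  partial sum \<open>S\<close> equals \<open>f s\<close>, so \<open>S\<^sup>2\<close> is at most
  \<open>K\<^sup>2 * b * S\<close>, which bounds \<open>S\<close> independently of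
  \<open>F\<close>.\<close>

lemma frame_functional_square_summable:
  fixes \<psi> :: "'i \<Rightarrow> 'k::real_inner" and f :: "'k \<Rightarrow> real"
  assumes "is_frame \<psi>" "bounded_linear f"
  shows "(\<lambda>i. (f (\<psi> i))\<^sup>2) summable_on UNIV"
proof -
  obtain b where b: "0 < b" "\<And>x. (\<lambda>i. (x \<bullet> \<psi> i)\<^sup>2) summable_on UNIV"
      "\<And>x. (\<Sum>\<^sub>\<infinity>i. (x \<bullet> \<psi> i)\<^sup>2) \<le> b * (norm x)\<^sup>2"
    using assms(1) unfolding is_frame_def by blast
  interpret f: bounded_linear f by fact
  obtain K where K: "\<And>x. norm (f x) \<le> norm x * K" using f.bounded by blast
  have "(\<Sum>i\<in>F. (f (\<psi> i))\<^sup>2) \<le> K\<^sup>2 * b" if F: "finite F" for F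
  proof -
    define S where "S = (\<Sum>i\<in>F. (f (\<psi> i))\<^sup>2)"
    have S0: "0 \<le> S" by (simp add: S_def sum_nonneg)
    define s where "s = (\<Sum>i\<in>F. f (\<psi> i) *\<^sub>R \<psi> i)"
    have "S = f s" by (simp add: S_def s_def f.sum f.scaleR power2_eq_square)
    then have "S\<^sup>2 \<le> (norm s * K)\<^sup>2"
      using K[of s] S0 by (intro power_mono) auto
    also have "\<dots> = K\<^sup>2 * (norm s)\<^sup>2" by (simp add: power_mult_distrib)
    also have "\<dots> \<le> K\<^sup>2 * (b * S)"
      unfolding s_def S_def by (intro mult_left_mono bessel_sum_bound[OF b F]) auto
    finally have "S * S \<le> (K\<^sup>2 * b) * S" by (simp add: power2_eq_square)
    then have "S \<le> K\<^sup>2 * b"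
      using S0 b(1) by (cases "S = 0") (auto simp: mult_le_cancel_right)
    then show ?thesis by (simp add: S_def)
  qed
  then show ?thesis by (intro summable_on_bounded_sums(1)[where B="K\<^sup>2 * b"]) auto
qed

lemma has_sum_sum:
  fixes f :: "'j \<Rightarrow> 'i \<Rightarrow> 'a::topological_comm_monoid_add"
  assumes "finite S" "\<And>j. j \<in> S \<Longrightarrow> (f j has_sum s j) A"
  shows "((\<lambda>i. \<Sum>j\<in>S. f j i) has_sum (\<Sum>j\<in>S. s j)) A"
  using assms by (induction S rule: finite_induct) (auto intro: has_sum_add)

lemma square_summable_sum:
  fixes f :: "'j \<Rightarrow> 'i \<Rightarrow> real"
  assumes "finite S" "\<And>j. j \<in> S \<Longrightarrow> (\<lambda>i. (f j i)\<^sup>2) summable_on UNIV"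
  shows "(\<lambda>i. (\<Sum>j\<in>S. f j i)\<^sup>2) summable_on UNIV"
  using assms
proof (induction S rule: finite_induct)
  case (insert a S)
  have "(\<lambda>i. 2 * (f a i)\<^sup>2 + 2 * (\<Sum>j\<in>S. f j i)\<^sup>2) summable_on UNIV"
    using insert by (intro summable_on_add summable_on_cmult_right) auto
  then show ?case
  proof (rule summable_on_comparison_test)
    fix i
    show "(\<Sum>j\<in>insert a S. f j i)\<^sup>2 \<le> 2 * (f a i)\<^sup>2 + 2 * (\<Sum>j\<in>S. f j i)\<^sup>2"
      using insert(1,2) sum_squares_bound[of "f a i" "\<Sum>j\<in>S. f j i"] by (simp add: power2_sum)
  qed simp
qed simp

text \<open>This is the only property of \<open>T\<close> that the rest of the argument uses; the sequence \<open>p\<close>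
  is \<open>T\<^sup>* w\<close>.\<close>

lemma T_op_adjoint:
  fixes \<psi> :: "'i \<Rightarrow> 'k::{real_inner, complete_space}"
    and A :: "'m::finite \<Rightarrow> 'n::finite \<Rightarrow> 'k \<Rightarrow> 'h::real_inner"
  assumes frame: "is_frame \<psi>" and A: "\<And>l j. bounded_linear (A l j)"
  shows "\<exists>p\<in>l2_space. \<forall>x\<in>l2_space. ((\<lambda>i. p i \<bullet> x i) has_sum (w \<bullet> T_op A \<psi> x)) UNIV"
proof -
  define p where "p = (\<lambda>i. \<chi> l. \<Sum>j\<in>UNIV. w $ j \<bullet> A l j (\<psi> i))"
  have nsq: "(norm z)\<^sup>2 = (\<Sum>l\<in>UNIV. (z $ l)\<^sup>2)" for z :: "real^'m"
    unfolding power2_norm_eq_inner inner_vec_def by (simp add: power2_eq_square)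
  have bl: "bounded_linear (\<lambda>k. w $ j \<bullet> A l j k)" for l j
    by (intro bounded_linear_compose[OF bounded_linear_inner_right A])
  have "p \<in> l2_space"
    unfolding l2_space_def mem_Collect_eq nsq
  proof (rule has_sum_imp_summable[OF has_sum_sum[OF _ has_sum_infsum]])
    fix l :: 'm
    show "(\<lambda>i. (p i $ l)\<^sup>2) summable_on UNIV"
      unfolding p_def vec_lambda_beta
      by (intro square_summable_sum frame_functional_square_summable[OF frame bl]) auto
  qed simp
  moreover have "((\<lambda>i. p i \<bullet> x i) has_sum (w \<bullet> T_op A \<psi> x)) UNIV" if x: "x \<in> l2_space" for x
  proof -
    have "(\<lambda>i. (x i $ l)\<^sup>2) summable_on UNIV" for l
    proof (rule summable_on_comparison_test)
      show "(\<lambda>i. (norm (x i))\<^sup>2) summable_on UNIV" using x by (simp add: l2_space_def)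
      show "(x i $ l)\<^sup>2 \<le> (norm (x i))\<^sup>2" for i
        unfolding nsq by (intro member_le_sum) auto
    qed simp
    then have hs: "((\<lambda>i. (x i $ l) *\<^sub>R \<psi> i) has_sum synthesis \<psi> (\<lambda>i. x i $ l)) UNIV" for l
      by (rule frame_synthesis_has_sum[OF frame])
    have "((\<lambda>i. \<Sum>j\<in>UNIV. \<Sum>l\<in>UNIV. w $ j \<bullet> A l j ((x i $ l) *\<^sub>R \<psi> i)) has_sum
        (\<Sum>j\<in>UNIV. \<Sum>l\<in>UNIV. w $ j \<bullet> A l j (synthesis \<psi> (\<lambda>i. x i $ l)))) UNIV"
      by (intro has_sum_sum has_sum_bounded_linear[OF bl hs] finite)
    moreover have "(\<Sum>j\<in>UNIV. \<Sum>l\<in>UNIV. w $ j \<bullet> A l j ((x i $ l) *\<^sub>R \<psi> i)) = p i \<bullet> x i" for i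
    proof -
      have "(\<Sum>j\<in>UNIV. \<Sum>l\<in>UNIV. w $ j \<bullet> A l j ((x i $ l) *\<^sub>R \<psi> i))
        = (\<Sum>j\<in>UNIV. \<Sum>l\<in>UNIV. (w $ j \<bullet> A l j (\<psi> i)) * x i $ l)"
        by (simp add: linear_simps(5)[OF A] mult.commute)
      also have "\<dots> = p i \<bullet> x i"
        by (subst sum.swap) (simp add: p_def inner_vec_def sum_distrib_right)
      finally show ?thesis .
    qed
    moreover have "(\<Sum>j\<in>UNIV. \<Sum>l\<in>UNIV. w $ j \<bullet> A l j (synthesis \<psi> (\<lambda>i. x i $ l))) = w \<bullet> T_op A \<psi> x"
      by (simp add: T_op_def inner_vec_def inner_sum_right)
    ultimately show ?thesis by simp
  qed
  ultimately show ?thesis by blast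
qed

section \<open>The functional and its minimizers in each variable\<close>

text \<open>Divide by \<open>t\<close> and let \<open>t\<close> tend to 0 from the right. This
  extracts first-order conditions from inequalities with a quadratic remainder.\<close>

lemma linear_coeff_nonneg:
  fixes a c :: real
  assumes "\<And>t. 0 < t \<Longrightarrow> t < 1 \<Longrightarrow> 0 \<le> t * a + t\<^sup>2 * c"
  shows "0 \<le> a"
proof (rule tendsto_lowerbound)
  have "((\<lambda>t. a + t * c) \<longlongrightarrow> a + 0 * c) (at_right 0)"
    by (intro tendsto_intros)
  then show "((\<lambda>t. a + t * c) \<longlongrightarrow> a) (at_right 0)" by simp
  have "0 \<le> a + t * c" if "0 < t" "t < 1" for t
  proof -
    have "0 \<le> t * (a + t * c)" using assms[OF that] by (simp add: algebra_simps power2_eq_square)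
    then show ?thesis using that by (simp add: zero_le_mult_iff)
  qed
  then show "\<forall>\<^sub>F t in at_right 0. 0 \<le> a + t * c"
    unfolding eventually_at_right_field by (intro exI[of _ 1]) auto
qed simp

lemma has_sum_single_support:
  fixes f :: "'i \<Rightarrow> 'a::{topological_comm_monoid_add, t2_space}"
  assumes "\<And>j. j \<noteq> i \<Longrightarrow> f j = 0"
  shows "(f has_sum f i) UNIV"
proof -
  have "(f has_sum sum f {i}) {i}" by (rule has_sum_finite) simp
  then show ?thesis
    using has_sum_cong_neutral[of UNIV "{i}" f f] assms by simp
qed

definition single :: "'i \<Rightarrow> 'a \<Rightarrow> 'i \<Rightarrow> 'a::zero" where
  "single i d = (\<lambda>_. 0)(i := d)"

section \<open>The functional in blocks, with an abstract norm and operator\<close>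

text \<open>\<open>N\<close> stands for the \<open>q\<close>-norm and is axiomatized as a seminorm.
  \<open>T\<close> is a bare function on families, whose linearity on \<open>l2_space\<close> is
  recovered from \<open>adjoint\<close>.\<close>

locale joint_sparsity_functional =
  fixes T :: "('i::countable \<Rightarrow> real ^ 'm::finite) \<Rightarrow> 'h::real_inner" and g :: 'h
    and N :: "real ^ 'm \<Rightarrow> real" and \<omega> \<theta> \<rho> :: "'i \<Rightarrow> real" and \<gamma> :: real
  assumes adjoint: "\<And>w. \<exists>p\<in>l2_space. \<forall>x\<in>l2_space. ((\<lambda>i. p i \<bullet> x i) has_sum (w \<bullet> T x)) UNIV"
    and N_scale: "\<And>c x. N (c *\<^sub>R x) = \<bar>c\<bar> * N x"
    and N_triangle: "\<And>x y. N (x + y) \<le> N x + N y"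
    and \<theta>_pos: "\<And>i. 0 < \<theta> i" and \<rho>_pos: "\<And>i. 0 < \<rho> i"
    and \<gamma>_pos: "0 < \<gamma>" and \<gamma>_le: "\<And>i. \<gamma> \<le> \<omega> i"
begin

definition phi :: "'i \<Rightarrow> real ^ 'm \<Rightarrow> real \<Rightarrow> real" where
  "phi i z y = y * N z + \<omega> i * (norm z)\<^sup>2 + \<theta> i * (\<rho> i - y)\<^sup>2"

text \<open>A wider class than the finite points over the cone: \<open>y i / \<rho> i\<close> may be
  unbounded here, while the minimizers \<open>V x\<close> lie in the cone by \<open>V_le\<close>.
  \<open>E\<close> is meaningful only on feasible pairs, as \<open>infsum\<close> is 0 on
  non-summable families.\<close>

definition feasible :: "('i \<Rightarrow> real ^ 'm) \<Rightarrow> ('i \<Rightarrow> real) \<Rightarrow> bool" where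
  "feasible x y \<longleftrightarrow> x \<in> l2_space \<and> (\<forall>i. 0 \<le> y i) \<and> (\<lambda>i. phi i (x i) (y i)) summable_on UNIV"

definition E :: "('i \<Rightarrow> real ^ 'm) \<Rightarrow> ('i \<Rightarrow> real) \<Rightarrow> real" where
  "E x y = (norm (T x - g))\<^sup>2 + (\<Sum>\<^sub>\<infinity>i. phi i (x i) (y i))"

definition V :: "('i \<Rightarrow> real ^ 'm) \<Rightarrow> 'i \<Rightarrow> real" where
  "V x i = max 0 (\<rho> i - N (x i) / (2 * \<theta> i))"

text \<open>The one-sided derivative at \<open>t = 0\<close> of \<open>E (\<cdot>) y\<close> along \<open>t \<mapsto> x + t d e\<^sub>i\<close>, with the derivative of
  \<open>N\<close> replaced by the larger difference quotient at \<open>t = 1\<close>.\<close>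

definition stationary :: "('i \<Rightarrow> real ^ 'm) \<Rightarrow> ('i \<Rightarrow> real) \<Rightarrow> bool" where
  "stationary x y \<longleftrightarrow> (\<forall>i d. 0 \<le> 2 * ((T x - g) \<bullet> T (single i d)) + 2 * \<omega> i * (x i \<bullet> d)
      + y i * (N (x i + d) - N (x i)))"

lemma \<omega>_pos: "0 < \<omega> i"
  using \<gamma>_pos \<gamma>_le[of i] by linarith

lemma N_zero: "N 0 = 0"
  using N_scale[of 0 0] by simp

lemma N_minus: "N (- x) = N x"
  using N_scale[of "-1" x] by simp

lemma N_nonneg: "0 \<le> N x"
  using N_triangle[of x "- x"] by (simp add: N_zero N_minus)

lemma N_abs_diff: "\<bar>N x - N y\<bar> \<le> N (x - y)"
  using N_triangle[of "x - y" y] N_triangle[of "y - x" x] N_minus[of "x - y"] by simp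

text \<open>Difference quotients of a convex function increase with the step, which permits the
  quotient at \<open>t = 1\<close> in \<open>stationary\<close>.\<close>

lemma N_convex:
  assumes "0 \<le> t" "t \<le> 1"
  shows "N (x + t *\<^sub>R d) - N x \<le> t * (N (x + d) - N x)"
proof -
  have "x + t *\<^sub>R d = (1 - t) *\<^sub>R x + t *\<^sub>R (x + d)" by (simp add: algebra_simps)
  then have "N (x + t *\<^sub>R d) \<le> (1 - t) * N x + t * N (x + d)"
    using N_triangle[of "(1 - t) *\<^sub>R x" "t *\<^sub>R (x + d)"] assms by (simp add: N_scale)
  then show ?thesis by (simp add: algebra_simps)
qed

lemma N_tendsto:
  assumes "(f \<longlongrightarrow> l) F"
  shows "((\<lambda>n. N (f n)) \<longlongrightarrow> N l) F"
proof -
  have "convex_on UNIV N"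
  proof (rule convex_onI)
    fix t :: real and x y assume "0 < t" "t < 1"
    then show "N ((1 - t) *\<^sub>R x + t *\<^sub>R y) \<le> (1 - t) * N x + t * N y"
      using N_triangle[of "(1 - t) *\<^sub>R x" "t *\<^sub>R y"] by (simp add: N_scale)
  qed simp
  then have "continuous_on UNIV N" by (intro convex_on_continuous) auto
  then show ?thesis using assms continuous_on_tendsto_compose by fastforce
qed

lemma V_tendsto:
  assumes "(\<lambda>n. x n i) \<longlonglongrightarrow> l i"
  shows "(\<lambda>n. V (x n) i) \<longlonglongrightarrow> V l i"
  unfolding V_def using \<theta>_pos[of i] by (intro tendsto_intros N_tendsto assms) auto

lemma V_nonneg: "0 \<le> V x i"
  by (simp add: V_def)

lemma V_le: "V x i \<le> \<rho> i"
  using \<rho>_pos[of i] \<theta>_pos[of i] N_nonneg[of "x i"] by (simp add: V_def)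

text \<open>Truncation at 0 is nonexpansive. This Lipschitz constant drives the contraction.\<close>

lemma V_abs_diff: "\<bar>V x i - V z i\<bar> \<le> N (x i - z i) / (2 * \<theta> i)"
proof -
  have "\<bar>V x i - V z i\<bar> \<le> \<bar>N (x i) / (2 * \<theta> i) - N (z i) / (2 * \<theta> i)\<bar>"
    unfolding V_def by (auto simp: max_def)
  also have "\<dots> = \<bar>N (x i) - N (z i)\<bar> / (2 * \<theta> i)"
    using \<theta>_pos[of i] by (simp add: diff_divide_distrib[symmetric] abs_divide)
  also have "\<dots> \<le> N (x i - z i) / (2 * \<theta> i)"
    using N_abs_diff \<theta>_pos[of i] by (intro divide_right_mono) auto
  finally show ?thesis .
qed

text \<open>The variational inequality for minimizing \<open>phi\<close> over \<open>y\<close> in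
  the half line: the second factor is the derivative at \<open>V x i\<close>. It vanishes unless the
  truncation is active, and then it is nonnegative.\<close>

lemma V_first_order:
  assumes "0 \<le> y"
  shows "0 \<le> (y - V x i) * (N (x i) - 2 * \<theta> i * (\<rho> i - V x i))"
proof (cases "\<rho> i - N (x i) / (2 * \<theta> i) \<le> 0")
  case True
  then have "0 \<le> N (x i) - 2 * \<theta> i * \<rho> i" using \<theta>_pos[of i] by (simp add: field_simps)
  then show ?thesis using True assms by (simp add: V_def)
next
  case False
  then have "V x i = \<rho> i - N (x i) / (2 * \<theta> i)" by (simp add: V_def)
  then have "N (x i) - 2 * \<theta> i * (\<rho> i - V x i) = 0" using \<theta>_pos[of i] by simp
  then show ?thesis by simp
qed

text \<open>\<open>phi\<close> is quadratic in \<open>y\<close> with leading coefficient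
  \<open>\<theta> i\<close>, so the first-order condition gives growth by that square.\<close>

lemma phi_V_le:
  assumes "0 \<le> y"
  shows "phi i (x i) (V x i) + \<theta> i * (y - V x i)\<^sup>2 \<le> phi i (x i) y"
proof -
  have "phi i (x i) y - phi i (x i) (V x i) - \<theta> i * (y - V x i)\<^sup>2
      = (y - V x i) * (N (x i) - 2 * \<theta> i * (\<rho> i - V x i))"
    by (simp add: phi_def algebra_simps power2_eq_square)
  then show ?thesis using V_first_order[OF assms, of x i] by linarith
qed

lemma phi_nonneg: "0 \<le> y \<Longrightarrow> 0 \<le> phi i z y"
  using N_nonneg \<omega>_pos[of i] \<theta>_pos[of i] by (simp add: phi_def)

lemma norm_le_phi: "0 \<le> y \<Longrightarrow> \<omega> i * (norm z)\<^sup>2 \<le> phi i z y"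
  using N_nonneg \<omega>_pos[of i] \<theta>_pos[of i] by (simp add: phi_def)

lemma infsum_phi_nonneg: "feasible x y \<Longrightarrow> 0 \<le> (\<Sum>\<^sub>\<infinity>i. phi i (x i) (y i))"
  by (intro infsum_nonneg phi_nonneg) (simp add: feasible_def)

lemma E_nonneg: "feasible x y \<Longrightarrow> 0 \<le> E x y"
  using infsum_phi_nonneg[of x y] by (simp add: E_def)

lemma weighted_summable:
  assumes "feasible x y"
  shows "(\<lambda>i. \<omega> i * (norm (x i))\<^sup>2) summable_on UNIV"
proof (rule summable_on_comparison_test)
  show "(\<lambda>i. phi i (x i) (y i)) summable_on UNIV" using assms by (simp add: feasible_def)
  show "\<omega> i * (norm (x i))\<^sup>2 \<le> phi i (x i) (y i)" for i
    using assms by (intro norm_le_phi) (simp add: feasible_def)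
  show "0 \<le> \<omega> i * (norm (x i))\<^sup>2" for i
    using \<omega>_pos[of i] by simp
qed

lemma weighted_norm_le_E:
  assumes f: "feasible x y"
  shows "(\<Sum>\<^sub>\<infinity>i. \<omega> i * (norm (x i))\<^sup>2) \<le> E x y"
proof -
  have "(\<Sum>\<^sub>\<infinity>i. \<omega> i * (norm (x i))\<^sup>2) \<le> (\<Sum>\<^sub>\<infinity>i. phi i (x i) (y i))"
  proof (rule infsum_mono[OF weighted_summable[OF f]])
    show "(\<lambda>i. phi i (x i) (y i)) summable_on UNIV" using f by (simp add: feasible_def)
    show "\<omega> i * (norm (x i))\<^sup>2 \<le> phi i (x i) (y i)" for i
      using f by (intro norm_le_phi) (simp add: feasible_def)
  qed
  then show ?thesis by (simp add: E_def add_increasing)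
qed

lemma norm_sum_le_weighted:
  assumes "(\<lambda>i. \<omega> i * (norm (x i))\<^sup>2) summable_on UNIV"
  shows "x \<in> l2_space" and "(\<Sum>\<^sub>\<infinity>i. (norm (x i))\<^sup>2) \<le> (\<Sum>\<^sub>\<infinity>i. \<omega> i * (norm (x i))\<^sup>2) / \<gamma>"
proof -
  have le: "(norm (x i))\<^sup>2 \<le> (1 / \<gamma>) * (\<omega> i * (norm (x i))\<^sup>2)" for i
    using \<gamma>_pos mult_right_mono[OF \<gamma>_le[of i], of "(norm (x i))\<^sup>2"] by (simp add: field_simps)
  have s: "(\<lambda>i. (1 / \<gamma>) * (\<omega> i * (norm (x i))\<^sup>2)) summable_on UNIV"
    by (rule summable_on_cmult_right[OF assms])
  then show x: "x \<in> l2_space"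
    unfolding l2_space_def mem_Collect_eq by (rule summable_on_comparison_test) (use le in auto)
  have "(\<Sum>\<^sub>\<infinity>i. (norm (x i))\<^sup>2) \<le> (\<Sum>\<^sub>\<infinity>i. (1 / \<gamma>) * (\<omega> i * (norm (x i))\<^sup>2))"
    using x by (intro infsum_mono s le) (simp add: l2_space_def)
  also have "\<dots> = (1 / \<gamma>) * (\<Sum>\<^sub>\<infinity>i. \<omega> i * (norm (x i))\<^sup>2)" by (rule infsum_cmult_right')
  finally show "(\<Sum>\<^sub>\<infinity>i. (norm (x i))\<^sup>2) \<le> (\<Sum>\<^sub>\<infinity>i. \<omega> i * (norm (x i))\<^sup>2) / \<gamma>" by simp
qed

lemma feasible_norm_sum_le:
  assumes "feasible x y"
  shows "(\<Sum>\<^sub>\<infinity>i. (norm (x i))\<^sup>2) \<le> E x y / \<gamma>"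
proof -
  note norm_sum_le_weighted(2)[OF weighted_summable[OF assms]]
  also have "(\<Sum>\<^sub>\<infinity>i. \<omega> i * (norm (x i))\<^sup>2) / \<gamma> \<le> E x y / \<gamma>"
    using weighted_norm_le_E[OF assms] \<gamma>_pos by (intro divide_right_mono) auto
  finally show ?thesis .
qed

lemma feasible_norm_le: "feasible x y \<Longrightarrow> norm (x i) \<le> sqrt (E x y / \<gamma>)"
proof (rule real_le_rsqrt)
  assume f: "feasible x y"
  have "(\<Sum>j\<in>{i}. (norm (x j))\<^sup>2) \<le> (\<Sum>\<^sub>\<infinity>i. (norm (x i))\<^sup>2)"
    using f by (intro finite_sum_le_infsum) (auto simp: feasible_def l2_space_def)
  then show "(norm (x i))\<^sup>2 \<le> E x y / \<gamma>"
    using feasible_norm_sum_le[OF f] by simp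
qed

section \<open>Linearity and weak continuity of \<open>T\<close>\<close>

lemma single_l2: "single i d \<in> l2_space"
  unfolding single_def by (intro l2_fun_upd) (simp add: l2_space_def)

lemma adjoint_single:
  assumes "\<forall>x\<in>l2_space. ((\<lambda>i. p i \<bullet> x i) has_sum (w \<bullet> T x)) UNIV"
  shows "w \<bullet> T (single i d) = p i \<bullet> d"
proof -
  have "((\<lambda>j. p j \<bullet> single i d j) has_sum (p i \<bullet> single i d i)) UNIV"
    by (rule has_sum_single_support) (simp add: single_def)
  then have "((\<lambda>j. p j \<bullet> single i d j) has_sum (p i \<bullet> d)) UNIV"
    by (simp add: single_def)
  with assms[rule_format, OF single_l2] show ?thesis by (rule has_sum_unique)
qed

lemma T_has_sum:
  assumes "x \<in> l2_space"
  shows "((\<lambda>i. w \<bullet> T (single i (x i))) has_sum (w \<bullet> T x)) UNIV"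
proof -
  obtain p where p: "\<forall>x\<in>l2_space. ((\<lambda>i. p i \<bullet> x i) has_sum (w \<bullet> T x)) UNIV"
    using adjoint by blast
  then show ?thesis using adjoint_single[OF p] assms by simp
qed

text \<open>Testing against every \<open>w\<close> reduces additivity of \<open>T\<close> to
  additivity of unordered sums.\<close>

lemma T_add:
  assumes "x \<in> l2_space" "z \<in> l2_space" "(\<lambda>i. x i + z i) \<in> l2_space"
  shows "T (\<lambda>i. x i + z i) = T x + T z"
proof (rule vector_eq_ldot[THEN iffD1], rule)
  fix w
  obtain p where p: "\<forall>x\<in>l2_space. ((\<lambda>i. p i \<bullet> x i) has_sum (w \<bullet> T x)) UNIV"
    using adjoint by blast
  have "((\<lambda>i. p i \<bullet> x i + p i \<bullet> z i) has_sum (w \<bullet> T x + w \<bullet> T z)) UNIV"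
    using p assms by (intro has_sum_add) auto
  then have sum: "((\<lambda>i. p i \<bullet> (x i + z i)) has_sum (w \<bullet> T x + w \<bullet> T z)) UNIV"
    by (simp add: inner_add_right)
  have "((\<lambda>i. p i \<bullet> (x i + z i)) has_sum (w \<bullet> T (\<lambda>i. x i + z i))) UNIV"
    by (rule p[rule_format, OF assms(3)])
  from has_sum_unique[OF this sum] show "w \<bullet> T (\<lambda>i. x i + z i) = w \<bullet> (T x + T z)"
    by (simp only: inner_add_right)
qed

lemma T_diff:
  assumes "x \<in> l2_space" "z \<in> l2_space"
  shows "T (\<lambda>i. x i - z i) = T x - T z"
  using T_add[OF l2_diff[OF assms] assms(2)] assms(1) by simp

lemma T_single_scale: "T (single i (t *\<^sub>R d)) = t *\<^sub>R T (single i d)"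
proof (rule vector_eq_ldot[THEN iffD1], rule)
  fix w
  obtain p where p: "\<forall>x\<in>l2_space. ((\<lambda>i. p i \<bullet> x i) has_sum (w \<bullet> T x)) UNIV"
    using adjoint by blast
  show "w \<bullet> T (single i (t *\<^sub>R d)) = w \<bullet> (t *\<^sub>R T (single i d))"
    by (simp add: adjoint_single[OF p])
qed

text \<open>Pairing \<open>w\<close> with \<open>T x\<close> is pairing \<open>x\<close> with a
  fixed element of \<open>l2_space\<close>, so \<open>l2_weak_limit\<close> applies.\<close>

lemma T_weak_limit:
  assumes "\<And>i. (\<lambda>n. x n i) \<longlonglongrightarrow> l i" "\<And>n. x n \<in> l2_space"
    "\<And>n. (\<Sum>\<^sub>\<infinity>i. (norm (x n i))\<^sup>2) \<le> B"
  shows "(\<lambda>n. w \<bullet> T (x n)) \<longlonglongrightarrow> w \<bullet> T l"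
proof -
  obtain p where p: "p \<in> l2_space" "\<forall>x\<in>l2_space. ((\<lambda>i. p i \<bullet> x i) has_sum (w \<bullet> T x)) UNIV"
    using adjoint by blast
  have "w \<bullet> T x = (\<Sum>\<^sub>\<infinity>i. p i \<bullet> x i)" if "x \<in> l2_space" for x
    using p(2) that by (metis infsumI)
  then show ?thesis
    using l2_weak_limit[OF assms p(1)] l2_pointwise_limit(1)[OF assms] assms(2) by simp
qed

section \<open>Comparison of energies and minimizers in one variable\<close>

text \<open>The common core of the energy comparisons. The linear terms sum to
  \<open>2 * ((T x - g) \<bullet> (T z - T x))\<close>, the first-order part of the data term at
  \<open>x\<close>, whose exact remainder is \<open>(norm (T z - T x))\<^sup>2\<close>;
  \<open>b\<close> collects the gain in each block.\<close>

lemma compare_E: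
  assumes x: "x \<in> l2_space" "\<And>i. 0 \<le> y i" and z: "feasible z y'"
    and b: "\<And>i. 0 \<le> b i"
    and le: "\<And>i. phi i (x i) (y i) + b i
       \<le> phi i (z i) (y' i) + 2 * ((T x - g) \<bullet> T (single i (z i - x i)))"
  shows "feasible x y" and "b summable_on UNIV"
    and "E x y + infsum b UNIV + (norm (T z - T x))\<^sup>2 \<le> E z y'"
proof -
  have zl: "z \<in> l2_space" and zs: "(\<lambda>i. phi i (z i) (y' i)) summable_on UNIV"
    using z by (auto simp: feasible_def)
  have "((\<lambda>i. (T x - g) \<bullet> T (single i (z i - x i))) has_sum (T x - g) \<bullet> (T z - T x)) UNIV"
    using T_has_sum[OF l2_diff[OF zl x(1)]] by (simp add: T_diff[OF zl x(1)])
  then have "((\<lambda>i. 2 * ((T x - g) \<bullet> T (single i (z i - x i)))) has_sum 2 * ((T x - g) \<bullet> (T z - T x))) UNIV"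
    by (rule has_sum_cmult_right)
  then have c: "((\<lambda>i. phi i (z i) (y' i) + 2 * ((T x - g) \<bullet> T (single i (z i - x i)))) has_sum
      infsum (\<lambda>i. phi i (z i) (y' i)) UNIV + 2 * ((T x - g) \<bullet> (T z - T x))) UNIV"
    using zs by (intro has_sum_add has_sum_infsum)
  have pn: "0 \<le> phi i (x i) (y i)" for i by (rule phi_nonneg[OF x(2)])
  have sp: "(\<lambda>i. phi i (x i) (y i)) summable_on UNIV"
  proof (rule summable_on_comparison_test[OF has_sum_imp_summable[OF c]])
    fix i show "phi i (x i) (y i) \<le> phi i (z i) (y' i) + 2 * ((T x - g) \<bullet> T (single i (z i - x i)))"
      using le[of i] b[of i] by linarith
  qed (rule pn)
  then show "feasible x y" using x by (simp add: feasible_def)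
  show sb: "b summable_on UNIV"
  proof (rule summable_on_comparison_test[OF has_sum_imp_summable[OF c]])
    fix i show "b i \<le> phi i (z i) (y' i) + 2 * ((T x - g) \<bullet> T (single i (z i - x i)))"
      using le[of i] pn[of i] by linarith
  qed (rule b)
  have "infsum (\<lambda>i. phi i (x i) (y i)) UNIV + infsum b UNIV
      \<le> infsum (\<lambda>i. phi i (z i) (y' i)) UNIV + 2 * ((T x - g) \<bullet> (T z - T x))"
    by (rule has_sum_mono[OF has_sum_add[OF has_sum_infsum[OF sp] has_sum_infsum[OF sb]] c]) (rule le)
  moreover have "(norm (T z - g))\<^sup>2 = (norm (T x - g))\<^sup>2 + 2 * ((T x - g) \<bullet> (T z - T x)) + (norm (T z - T x))\<^sup>2"
    unfolding power2_norm_eq_inner by (simp add: algebra_simps inner_commute)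
  ultimately show "E x y + infsum b UNIV + (norm (T z - T x))\<^sup>2 \<le> E z y'"
    by (simp add: E_def)
qed

text \<open>At \<open>d = z i - x i\<close> the one-block inequality contains the full increment of
  \<open>N\<close>, so no limit is taken; expanding \<open>norm (z i)\<close> around
  \<open>x i\<close> leaves the quadratic gain.\<close>

lemma stationary_growth:
  assumes x: "x \<in> l2_space" "stationary x y" and z: "feasible z y"
  shows "feasible x y" and "(\<lambda>i. \<omega> i * (norm (z i - x i))\<^sup>2) summable_on UNIV"
    and "E x y + (\<Sum>\<^sub>\<infinity>i. \<omega> i * (norm (z i - x i))\<^sup>2) \<le> E z y"
proof -
  have y: "0 \<le> y i" for i using z by (simp add: feasible_def)
  have le: "phi i (x i) (y i) + \<omega> i * (norm (z i - x i))\<^sup>2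
       \<le> phi i (z i) (y i) + 2 * ((T x - g) \<bullet> T (single i (z i - x i)))" for i
  proof -
    have "0 \<le> 2 * ((T x - g) \<bullet> T (single i (z i - x i))) + 2 * \<omega> i * (x i \<bullet> (z i - x i))
        + y i * (N (z i) - N (x i))"
      using x(2)[unfolded stationary_def, rule_format, of i "z i - x i"] by simp
    moreover have "\<omega> i * (norm (z i))\<^sup>2
        = \<omega> i * (norm (x i))\<^sup>2 + 2 * \<omega> i * (x i \<bullet> (z i - x i)) + \<omega> i * (norm (z i - x i))\<^sup>2"
      unfolding power2_norm_eq_inner by (simp add: algebra_simps inner_commute)
    ultimately show ?thesis by (simp add: phi_def algebra_simps)
  qed
  have b: "0 \<le> \<omega> i * (norm (z i - x i))\<^sup>2" for i using \<omega>_pos[of i] by simp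
  note c = compare_E[OF x(1) y z b le]
  show "feasible x y" "(\<lambda>i. \<omega> i * (norm (z i - x i))\<^sup>2) summable_on UNIV"
    by (rule c(1), rule c(2))
  show "E x y + (\<Sum>\<^sub>\<infinity>i. \<omega> i * (norm (z i - x i))\<^sup>2) \<le> E z y"
    using c(3) zero_le_power2[of "norm (T z - T x)"] by linarith
qed

lemma stationary_unique:
  assumes "x \<in> l2_space" "stationary x y" "feasible z y" "z \<noteq> x"
  shows "E x y < E z y"
proof -
  note G = stationary_growth[OF assms(1-3)]
  obtain i where i: "z i \<noteq> x i" using assms(4) by blast
  have "0 < (\<Sum>j\<in>{i}. \<omega> j * (norm (z j - x j))\<^sup>2)" using i \<omega>_pos[of i] by simp
  also have "\<dots> \<le> (\<Sum>\<^sub>\<infinity>i. \<omega> i * (norm (z i - x i))\<^sup>2)"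
    using \<omega>_pos by (intro finite_sum_le_infsum G(2)) (auto simp: less_imp_le)
  finally show ?thesis using G(3) by linarith
qed

text \<open>The case \<open>z = x\<close> of \<open>compare_E\<close>: the linear terms vanish and
  \<open>phi_V_le\<close> supplies the gain.\<close>

lemma V_minimal:
  assumes "feasible x y"
  shows "feasible x (V x)" and "y \<noteq> V x \<Longrightarrow> E x (V x) < E x y"
proof -
  have y: "0 \<le> y i" for i using assms by (simp add: feasible_def)
  have x: "x \<in> l2_space" using assms by (simp add: feasible_def)
  have b: "0 \<le> \<theta> i * (y i - V x i)\<^sup>2" for i using \<theta>_pos[of i] by simp
  have T0: "T (single i 0) = 0" for i using T_single_scale[of i 0 0] by simp
  have le: "phi i (x i) (V x i) + \<theta> i * (y i - V x i)\<^sup>2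
       \<le> phi i (x i) (y i) + 2 * ((T x - g) \<bullet> T (single i (x i - x i)))" for i
    using phi_V_le[OF y, of i x] by (simp add: T0)
  note c = compare_E[OF x V_nonneg assms b le]
  show "feasible x (V x)" by (rule c)
  assume "y \<noteq> V x"
  then obtain i where i: "y i \<noteq> V x i" by blast
  have "0 < (\<Sum>j\<in>{i}. \<theta> j * (y j - V x j)\<^sup>2)" using i \<theta>_pos[of i] by simp
  also have "\<dots> \<le> (\<Sum>\<^sub>\<infinity>i. \<theta> i * (y i - V x i)\<^sup>2)"
    by (intro finite_sum_le_infsum c(2) b) auto
  finally show "E x (V x) < E x y" using c(3) by simp
qed

lemma V_le_E: "feasible x y \<Longrightarrow> E x (V x) \<le> E x y"
  using V_minimal(2) by (cases "y = V x") (auto simp: less_imp_le)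

text \<open>Moving block \<open>i\<close> by \<open>t *\<^sub>R d\<close> changes the energy by at
  most a linear plus a quadratic term in \<open>t\<close>, once convexity of \<open>N\<close> bounds
  its increment linearly; minimality makes the linear coefficient nonnegative.\<close>

lemma minimizer_stationary:
  assumes x: "feasible x y" and min: "\<And>z. feasible z y \<Longrightarrow> E x y \<le> E z y"
  shows "stationary x y"
  unfolding stationary_def
proof (intro allI)
  fix i d
  have xl: "x \<in> l2_space" and y: "\<And>i. 0 \<le> y i" and s: "(\<lambda>i. phi i (x i) (y i)) summable_on UNIV"
    using x by (auto simp: feasible_def)
  let ?c = "(T x - g) \<bullet> T (single i d)"
  show "0 \<le> 2 * ?c + 2 * \<omega> i * (x i \<bullet> d) + y i * (N (x i + d) - N (x i))"
  proof (rule linear_coeff_nonneg)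
    fix t :: real assume t: "0 < t" "t < 1"
    define z where "z = x(i := x i + t *\<^sub>R d)"
    have zl: "z \<in> l2_space" unfolding z_def by (rule l2_fun_upd[OF xl])
    have z_eq: "z = (\<lambda>j. x j + single i (t *\<^sub>R d) j)" by (auto simp: z_def single_def)
    have Tz: "T z = T x + t *\<^sub>R T (single i d)"
      using T_add[OF xl single_l2, of i "t *\<^sub>R d"] zl by (simp add: z_eq T_single_scale)
    \<comment> \<open>Only summand \<open>i\<close> changes, so the sum moves by this one number and
      stays summable.\<close>
    let ?\<delta> = "phi i (z i) (y i) - phi i (x i) (y i)"
    have "(single i ?\<delta> has_sum single i ?\<delta> i) UNIV"
      by (rule has_sum_single_support) (simp add: single_def)
    then have "(single i ?\<delta> has_sum ?\<delta>) UNIV" by (simp add: single_def)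
    then have "((\<lambda>j. phi j (x j) (y j) + single i ?\<delta> j) has_sum
        (\<Sum>\<^sub>\<infinity>j. phi j (x j) (y j)) + ?\<delta>) UNIV"
      by (intro has_sum_add has_sum_infsum s)
    moreover have "(\<lambda>j. phi j (x j) (y j) + single i ?\<delta> j) = (\<lambda>j. phi j (z j) (y j))"
      by (auto simp: single_def z_def)
    ultimately have hs: "((\<lambda>j. phi j (z j) (y j)) has_sum (\<Sum>\<^sub>\<infinity>j. phi j (x j) (y j)) + ?\<delta>) UNIV"
      by simp
    then have fz: "feasible z y" using zl y by (auto simp: feasible_def dest: has_sum_imp_summable)
    have "E x y \<le> E z y" by (rule min[OF fz])
    then have "0 \<le> (norm (T z - g))\<^sup>2 - (norm (T x - g))\<^sup>2 + ?\<delta>"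
      using infsumI[OF hs] by (simp add: E_def)
    also have "(norm (T z - g))\<^sup>2 - (norm (T x - g))\<^sup>2 = t * (2 * ?c) + t\<^sup>2 * (norm (T (single i d)))\<^sup>2"
      unfolding power2_norm_eq_inner Tz by (simp add: algebra_simps inner_commute power2_eq_square)
    also have "?\<delta> = y i * (N (x i + t *\<^sub>R d) - N (x i)) + t * (2 * \<omega> i * (x i \<bullet> d)) + t\<^sup>2 * (\<omega> i * (norm d)\<^sup>2)"
      unfolding phi_def power2_norm_eq_inner by (simp add: z_def algebra_simps inner_commute power2_eq_square)
    also have "y i * (N (x i + t *\<^sub>R d) - N (x i)) \<le> t * (y i * (N (x i + d) - N (x i)))"
      using mult_left_mono[OF N_convex[of t "x i" d] y] t by (simp add: mult.left_commute)
    finally show "0 \<le> t * (2 * ?c + 2 * \<omega> i * (x i \<bullet> d) + y i * (N (x i + d) - N (x i)))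
        + t\<^sup>2 * ((norm (T (single i d)))\<^sup>2 + \<omega> i * (norm d)\<^sup>2)"
      by (simp add: algebra_simps)
  qed
qed

text \<open>The direct method: a minimizing sequence is bounded, a subsequence converges in every
  block, and the energy is lower semicontinuous along it.\<close>

lemma minimizer_exists:
  assumes x0: "feasible x0 y"
  shows "\<exists>x. feasible x y \<and> (\<forall>z. feasible z y \<longrightarrow> E x y \<le> E z y)"
proof -
  define m where "m = Inf {E z y |z. feasible z y}"
  have bdd: "bdd_below {E z y |z. feasible z y}"
    using E_nonneg by (intro bdd_belowI[of _ 0]) auto
  have m_le: "m \<le> E z y" if "feasible z y" for z
    unfolding m_def using that by (intro cInf_lower bdd) auto
  have "\<exists>z. feasible z y \<and> E z y < m + 1 / Suc n" for n
  proof -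
    have "\<exists>e\<in>{E z y |z. feasible z y}. e < m + 1 / Suc n"
      using x0 cInf_lessD[of "{E z y |z. feasible z y}" "m + 1 / Suc n"] by (auto simp: m_def)
    then show ?thesis by blast
  qed
  then obtain X where X: "\<And>n. feasible (X n) y" "\<And>n. E (X n) y < m + 1 / Suc n" by metis
  have Xm: "E (X n) y \<le> m + 1" for n
    using X(2)[of n] by (smt (verit) divide_le_eq_1 of_nat_0_less_iff of_nat_Suc of_nat_0_le_iff)
  then have Xm': "E (X n) y / \<gamma> \<le> (m + 1) / \<gamma>" for n
    using \<gamma>_pos by (intro divide_right_mono) auto
  have "norm (X n i) \<le> sqrt ((m + 1) / \<gamma>)" for n i
    by (rule order_trans[OF feasible_norm_le[OF X(1)] real_sqrt_le_mono[OF Xm']])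
  from bounded_sequence_pointwise_subseq[of X, OF this]
  obtain l s where s: "strict_mono s" "\<And>i. (\<lambda>k. X (s k) i) \<longlonglongrightarrow> l i" by blast
  have Xl: "X n \<in> l2_space" for n using X(1) by (simp add: feasible_def)
  have XB: "(\<Sum>\<^sub>\<infinity>i. (norm (X n i))\<^sup>2) \<le> (m + 1) / \<gamma>" for n
    by (rule order_trans[OF feasible_norm_sum_le[OF X(1)] Xm'])
  have l: "l \<in> l2_space" by (rule l2_pointwise_limit(1)[OF s(2) Xl XB])
  have y: "0 \<le> y i" for i using x0 by (simp add: feasible_def)
  \<comment> \<open>Lower semicontinuity of the data term:
    \<open>2 * (w \<bullet> (T z - g)) - (norm w)\<^sup>2\<close> is an affine minorant of
    \<open>(norm (T z - g))\<^sup>2\<close>, exact at \<open>z = l\<close>, and it passes to weak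
    limits.\<close>
  define w where "w = T l - g"
  have bound: "(norm w)\<^sup>2 + (\<Sum>i\<in>F. phi i (l i) (y i)) \<le> m" if F: "finite F" for F
  proof (rule tendsto_le)
    have "(\<lambda>k. 2 * (w \<bullet> T (X (s k)) - w \<bullet> g) - (norm w)\<^sup>2 + (\<Sum>i\<in>F. phi i (X (s k) i) (y i)))
        \<longlonglongrightarrow> 2 * (w \<bullet> T l - w \<bullet> g) - (norm w)\<^sup>2 + (\<Sum>i\<in>F. phi i (l i) (y i))"
      unfolding phi_def by (intro tendsto_intros T_weak_limit[OF s(2) Xl XB] N_tendsto s(2))
    moreover have "w \<bullet> T l - w \<bullet> g = (norm w)\<^sup>2"
      by (simp add: w_def power2_norm_eq_inner inner_diff_right)
    ultimately show "(\<lambda>k. 2 * (w \<bullet> T (X (s k)) - w \<bullet> g) - (norm w)\<^sup>2 + (\<Sum>i\<in>F. phi i (X (s k) i) (y i)))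
        \<longlonglongrightarrow> (norm w)\<^sup>2 + (\<Sum>i\<in>F. phi i (l i) (y i))" by simp
    have "(\<lambda>n. m + 1 / real (Suc n)) \<longlonglongrightarrow> m + 0"
      using LIMSEQ_Suc[OF lim_inverse_n'] by (intro tendsto_add tendsto_const) simp
    then show "(\<lambda>k. m + 1 / real (Suc (s k))) \<longlonglongrightarrow> m"
      using LIMSEQ_subseq_LIMSEQ[OF _ s(1)] by (auto simp: o_def)
    show "\<forall>\<^sub>F k in sequentially. 2 * (w \<bullet> T (X (s k)) - w \<bullet> g) - (norm w)\<^sup>2
        + (\<Sum>i\<in>F. phi i (X (s k) i) (y i)) \<le> m + 1 / real (Suc (s k))"
    proof (rule always_eventually, rule)
      fix k
      have "(\<Sum>i\<in>F. phi i (X (s k) i) (y i)) \<le> (\<Sum>\<^sub>\<infinity>i. phi i (X (s k) i) (y i))"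
        using X(1) F phi_nonneg[OF y] by (intro finite_sum_le_infsum) (auto simp: feasible_def)
      moreover have "2 * (w \<bullet> T (X (s k)) - w \<bullet> g) - (norm w)\<^sup>2 \<le> (norm (T (X (s k)) - g))\<^sup>2"
        using zero_le_power2[of "norm (w - (T (X (s k)) - g))"]
        unfolding power2_norm_eq_inner by (simp add: algebra_simps inner_commute)
      ultimately show "2 * (w \<bullet> T (X (s k)) - w \<bullet> g) - (norm w)\<^sup>2
        + (\<Sum>i\<in>F. phi i (X (s k) i) (y i)) \<le> m + 1 / real (Suc (s k))"
        using X(2)[of "s k"] by (simp add: E_def)
    qed
  qed simp
  have "(\<lambda>i. phi i (l i) (y i)) summable_on UNIV"
    and "(\<Sum>\<^sub>\<infinity>i. phi i (l i) (y i)) \<le> m - (norm w)\<^sup>2"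
    using summable_on_bounded_sums[of "\<lambda>i. phi i (l i) (y i)" "m - (norm w)\<^sup>2", OF phi_nonneg[OF y]] bound
    by (auto simp: algebra_simps)
  then have "feasible l y" "E l y \<le> m"
    using l y by (auto simp: feasible_def E_def w_def)
  then show ?thesis using m_le by (meson order_trans)
qed

end

section \<open>Joint minimality and convergence\<close>

locale strictly_convex_functional = joint_sparsity_functional +
  assumes phi_strict: "\<And>i z y z' y' t. 0 \<le> y \<Longrightarrow> 0 \<le> y' \<Longrightarrow> 0 < t \<Longrightarrow> t < 1 \<Longrightarrow> (z, y) \<noteq> (z', y') \<Longrightarrow>
    phi i (t *\<^sub>R z + (1 - t) *\<^sub>R z') (t * y + (1 - t) * y') < t * phi i z y + (1 - t) * phi i z' y'"
begin

text \<open>The product \<open>y N(z)\<close> couples the blocks, but its one-sided directional derivative is the sum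
  of the two partial ones up to a term of second order. This is why blockwise optimality implies
  joint optimality although \<open>N\<close> is not differentiable.\<close>

lemma joint_first_order:
  assumes st: "stationary x (V x)" and y: "0 \<le> y"
  shows "phi i (x i) (V x i) \<le> phi i z y + 2 * ((T x - g) \<bullet> T (single i (z - x i)))"
proof -
  define d where "d = z - x i"
  define e where "e = y - V x i"
  define c where "c = 2 * ((T x - g) \<bullet> T (single i d))"
  have "0 \<le> phi i z y - phi i (x i) (V x i) + c"
  proof (rule linear_coeff_nonneg)
    fix t :: real assume t: "0 < t" "t < 1"
    have "phi i (t *\<^sub>R z + (1 - t) *\<^sub>R x i) (t * y + (1 - t) * V x i)
        \<le> t * phi i z y + (1 - t) * phi i (x i) (V x i)"
    proof (cases "(z, y) = (x i, V x i)")
      case True then show ?thesis by (simp add: algebra_simps scaleR_left_distrib[symmetric])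
    next
      case False then show ?thesis using phi_strict[OF y V_nonneg t False] by (simp add: less_imp_le)
    qed
    moreover have "t *\<^sub>R z + (1 - t) *\<^sub>R x i = x i + t *\<^sub>R d" "t * y + (1 - t) * V x i = V x i + t * e"
      by (simp_all add: d_def e_def algebra_simps)
    ultimately have conv: "phi i (x i + t *\<^sub>R d) (V x i + t * e) - phi i (x i) (V x i)
        \<le> t * (phi i z y - phi i (x i) (V x i))"
      by (simp add: algebra_simps)
    \<comment> \<open>Stationarity is taken in direction \<open>t *\<^sub>R d\<close> instead of
      \<open>d\<close>, so that it carries the same increment of \<open>N\<close> as the expansion
      of \<open>phi\<close> below and the two cancel.\<close>
    have s: "0 \<le> t * c + t * (2 * \<omega> i * (x i \<bullet> d)) + V x i * (N (x i + t *\<^sub>R d) - N (x i))"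
      using st[unfolded stationary_def, rule_format, of i "t *\<^sub>R d"]
      by (simp add: T_single_scale c_def algebra_simps)
    have "0 \<le> t * (e * (N (x i) - 2 * \<theta> i * (\<rho> i - V x i)))"
      using V_first_order[OF y, of x i] t by (simp add: e_def)
    moreover have "- (t\<^sup>2 * (\<bar>e\<bar> * N d)) \<le> t * (e * (N (x i + t *\<^sub>R d) - N (x i)))"
    proof -
      have "\<bar>N (x i + t *\<^sub>R d) - N (x i)\<bar> \<le> t * N d"
        using N_abs_diff[of "x i + t *\<^sub>R d" "x i"] t by (simp add: N_scale)
      then have "\<bar>t * (e * (N (x i + t *\<^sub>R d) - N (x i)))\<bar> \<le> t * (\<bar>e\<bar> * (t * N d))"
        using t by (simp add: abs_mult mult_left_mono)
      then show ?thesis by (simp add: power2_eq_square abs_le_iff algebra_simps)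
    qed
    moreover have "phi i (x i + t *\<^sub>R d) (V x i + t * e) - phi i (x i) (V x i)
      = V x i * (N (x i + t *\<^sub>R d) - N (x i)) + t * (e * (N (x i + t *\<^sub>R d) - N (x i)))
        + t * (e * (N (x i) - 2 * \<theta> i * (\<rho> i - V x i))) + t * (2 * \<omega> i * (x i \<bullet> d))
        + t\<^sup>2 * (\<omega> i * (norm d)\<^sup>2 + \<theta> i * e\<^sup>2)"
      unfolding phi_def power2_norm_eq_inner
      by (simp add: algebra_simps inner_commute power2_eq_square)
    moreover have "0 \<le> t\<^sup>2 * (\<omega> i * (norm d)\<^sup>2 + \<theta> i * e\<^sup>2)"
      using \<omega>_pos[of i] \<theta>_pos[of i] by simp
    ultimately show "0 \<le> t * (phi i z y - phi i (x i) (V x i) + c) + t\<^sup>2 * (\<bar>e\<bar> * N d)"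
      using conv s by (simp add: algebra_simps)
  qed
  then show ?thesis by (simp add: c_def d_def)
qed

text \<open>The weak inequality is applied at the midpoint of the two points. There strict convexity
  lowers \<open>phi\<close> strictly, while the linear term is exactly halved.\<close>

lemma joint_first_order_strict:
  assumes st: "stationary x (V x)" and y: "0 \<le> y" and ne: "(z, y) \<noteq> (x i, V x i)"
  shows "phi i (x i) (V x i) < phi i z y + 2 * ((T x - g) \<bullet> T (single i (z - x i)))"
proof -
  let ?z = "(1/2) *\<^sub>R z + (1 - 1/2) *\<^sub>R x i" and ?y = "1/2 * y + (1 - 1/2) * V x i"
  have "?z - x i = (1/2) *\<^sub>R (z - x i)"
    by (simp add: algebra_simps scaleR_left_distrib[symmetric])
  then have T: "T (single i (?z - x i)) = (1/2) *\<^sub>R T (single i (z - x i))"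
    by (simp only: T_single_scale)
  have "phi i (x i) (V x i) \<le> phi i ?z ?y + 2 * ((T x - g) \<bullet> T (single i (?z - x i)))"
    by (rule joint_first_order[OF st]) (use y V_nonneg in auto)
  moreover have "phi i ?z ?y < 1/2 * phi i z y + (1 - 1/2) * phi i (x i) (V x i)"
    by (rule phi_strict[OF y V_nonneg _ _ ne]) auto
  ultimately show ?thesis unfolding T by simp
qed

text \<open>The slack of the first-order inequality in each block serves as the gain in
  \<open>compare_E\<close>; it is positive in any block where the points differ.\<close>

lemma stationary_joint_minimizer:
  assumes x: "x \<in> l2_space" "stationary x (V x)" and z: "feasible z y"
  shows "feasible x (V x)" and "(z, y) \<noteq> (x, V x) \<Longrightarrow> E x (V x) < E z y"
proof -
  have y: "0 \<le> y i" for i using z by (simp add: feasible_def)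
  define b where "b = (\<lambda>i. phi i (z i) (y i) + 2 * ((T x - g) \<bullet> T (single i (z i - x i)))
      - phi i (x i) (V x i))"
  have b: "0 \<le> b i" for i
    using joint_first_order[OF x(2) y, of i "z i"] by (simp add: b_def)
  have le: "phi i (x i) (V x i) + b i
       \<le> phi i (z i) (y i) + 2 * ((T x - g) \<bullet> T (single i (z i - x i)))" for i
    by (simp add: b_def)
  note c = compare_E[OF x(1) V_nonneg z b le]
  show "feasible x (V x)" by (rule c(1))
  assume "(z, y) \<noteq> (x, V x)"
  then obtain i where "(z i, y i) \<noteq> (x i, V x i)" by (auto simp: fun_eq_iff)
  then have "0 < (\<Sum>j\<in>{i}. b j)"
    using joint_first_order_strict[OF x(2) y, of "z i" i i] by (simp add: b_def)
  also have "\<dots> \<le> infsum b UNIV"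
    by (intro finite_sum_le_infsum c(2) b) auto
  finally show "E x (V x) < E z y"
    using c(3) zero_le_power2[of "norm (T z - T x)"] by linarith
qed

end

section \<open>Energy descent and cluster points of the iteration\<close>

text \<open>The iteration says nothing about \<open>u 0\<close>, and \<open>v 0\<close> need not
  have the form \<open>V x\<close>; hence the shift to \<open>Suc n\<close> throughout.\<close>

locale alternating_minimization = strictly_convex_functional T g N \<omega> \<theta> \<rho> \<gamma>
  for T :: "('i::countable \<Rightarrow> real ^ 'm::finite) \<Rightarrow> 'h::real_inner" and g N \<omega> \<theta> \<rho> \<gamma> +
  fixes u :: "nat \<Rightarrow> 'i \<Rightarrow> real ^ 'm" and v :: "nat \<Rightarrow> 'i \<Rightarrow> real"
  assumes u_feasible: "\<And>n. feasible (u (Suc n)) (v n)"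
    and u_stationary: "\<And>n. stationary (u (Suc n)) (v n)"
    and v_eq: "\<And>n. v (Suc n) = V (u (Suc n))"
begin

lemma uv_feasible: "feasible (u (Suc n)) (v (Suc n))"
  using V_minimal(1)[OF u_feasible] by (simp add: v_eq)

lemma u_l2: "u (Suc n) \<in> l2_space"
  using u_feasible by (auto simp: feasible_def)

text \<open>The growth estimate for the \<open>u\<close>-step, compared with the previous iterate;
  the following \<open>v\<close>-step can only lower the energy further.\<close>

lemma E_decrease:
  "E (u (Suc (Suc n))) (v (Suc (Suc n))) + (\<Sum>\<^sub>\<infinity>i. \<omega> i * (norm (u (Suc n) i - u (Suc (Suc n)) i))\<^sup>2)
    \<le> E (u (Suc n)) (v (Suc n))"
  using stationary_growth(3)[OF u_l2 u_stationary uv_feasible, of n]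
    V_le_E[OF u_feasible, of "Suc n"] by (simp add: v_eq)

lemma E_decseq: "decseq (\<lambda>n. E (u (Suc n)) (v (Suc n)))"
proof (rule decseq_SucI)
  fix n
  have "0 \<le> (\<Sum>\<^sub>\<infinity>i. \<omega> i * (norm (u (Suc n) i - u (Suc (Suc n)) i))\<^sup>2)"
    using \<omega>_pos by (intro infsum_nonneg) (simp add: less_imp_le)
  then show "E (u (Suc (Suc n))) (v (Suc (Suc n))) \<le> E (u (Suc n)) (v (Suc n))"
    using E_decrease[of n] by linarith
qed

lemma E_le: "E (u (Suc n)) (v (Suc n)) \<le> E (u (Suc 0)) (v (Suc 0))"
  using decseqD[OF E_decseq, of 0 n] by simp

lemma u_norm_sum_le: "(\<Sum>\<^sub>\<infinity>i. (norm (u (Suc n) i))\<^sup>2) \<le> E (u (Suc 0)) (v (Suc 0)) / \<gamma>"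
  using feasible_norm_sum_le[OF uv_feasible, of n] divide_right_mono[OF E_le, of \<gamma> n] \<gamma>_pos by simp

lemma u_norm_le: "norm (u (Suc n) i) \<le> sqrt (E (u (Suc 0)) (v (Suc 0)) / \<gamma>)"
  by (rule order_trans[OF feasible_norm_le[OF uv_feasible]
        real_sqrt_le_mono[OF divide_right_mono[OF E_le less_imp_le[OF \<gamma>_pos]]]])

text \<open>The energies decrease and are nonnegative, so their differences tend to 0, and these
  dominate the weighted squared step in every single block.\<close>

lemma u_step_null: "(\<lambda>n. u (Suc n) i - u (Suc (Suc n)) i) \<longlonglongrightarrow> 0"
proof -
  let ?e = "\<lambda>n. E (u (Suc n)) (v (Suc n))"
  obtain L where L: "?e \<longlonglongrightarrow> L"
    using decseq_convergent[OF E_decseq, of 0] E_nonneg[OF uv_feasible] by blast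
  have le: "\<omega> i * (norm (u (Suc n) i - u (Suc (Suc n)) i))\<^sup>2 \<le> ?e n - ?e (Suc n)" for n
  proof -
    have "(\<Sum>j\<in>{i}. \<omega> j * (norm (u (Suc n) j - u (Suc (Suc n)) j))\<^sup>2)
      \<le> (\<Sum>\<^sub>\<infinity>j. \<omega> j * (norm (u (Suc n) j - u (Suc (Suc n)) j))\<^sup>2)"
      using stationary_growth(2)[OF u_l2 u_stationary uv_feasible] \<omega>_pos
      by (intro finite_sum_le_infsum) (auto simp: less_imp_le)
    then show ?thesis using E_decrease[of n] by simp
  qed
  have "(\<lambda>n. ?e n - ?e (Suc n)) \<longlonglongrightarrow> L - L"
    by (rule tendsto_diff[OF L LIMSEQ_Suc[OF L]])
  then have null: "(\<lambda>n. ?e n - ?e (Suc n)) \<longlonglongrightarrow> 0" by simp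
  have "(\<lambda>n. \<omega> i * (norm (u (Suc n) i - u (Suc (Suc n)) i))\<^sup>2) \<longlonglongrightarrow> 0"
  proof (rule tendsto_sandwich[OF always_eventually always_eventually tendsto_const null])
    show "\<forall>n. 0 \<le> \<omega> i * (norm (u (Suc n) i - u (Suc (Suc n)) i))\<^sup>2"
      using \<omega>_pos[of i] by simp
  qed (use le in blast)
  from tendsto_mult_left[OF this, of "1 / \<omega> i"]
  have "(\<lambda>n. (norm (u (Suc n) i - u (Suc (Suc n)) i))\<^sup>2) \<longlonglongrightarrow> 0"
    using \<omega>_pos[of i] by simp
  from tendsto_real_sqrt[OF this] show ?thesis
    by (simp add: tendsto_norm_zero_iff)
qed

text \<open>Each one-block inequality involves only block \<open>i\<close> and a pairing of
  \<open>T\<close> with a fixed vector, so it survives blockwise limits of a bounded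
  sequence.\<close>

lemma stationary_cluster_point:
  fixes r :: "nat \<Rightarrow> nat"
  assumes r: "strict_mono r"
  obtains s :: "nat \<Rightarrow> nat" and l where "strict_mono s" "\<And>i. (\<lambda>k. u (Suc (r (s k))) i) \<longlonglongrightarrow> l i"
    "l \<in> l2_space" "stationary l (V l)"
proof -
  obtain l s where s: "strict_mono s" "\<And>i. (\<lambda>k. u (Suc (r (s k))) i) \<longlonglongrightarrow> l i"
    using bounded_sequence_pointwise_subseq[of "\<lambda>k. u (Suc (r k))"
        "\<lambda>i. sqrt (E (u (Suc 0)) (v (Suc 0)) / \<gamma>)", OF u_norm_le] by blast
  have l: "l \<in> l2_space" by (rule l2_pointwise_limit(1)[OF s(2) u_l2 u_norm_sum_le])
  have "strict_mono (\<lambda>k. r (s k))" using strict_mono_o[OF r s(1)] by (simp add: o_def)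
  then have step: "(\<lambda>k. u (Suc (r (s k))) i - u (Suc (Suc (r (s k)))) i) \<longlonglongrightarrow> 0" for i
    using LIMSEQ_subseq_LIMSEQ[OF u_step_null] by (auto simp: o_def)
  \<comment> \<open>\<open>u_stationary\<close> couples \<open>u\<close> at one index with
    \<open>V\<close> at the preceding one; vanishing steps give both the same limit.\<close>
  have lim: "(\<lambda>k. u (Suc (Suc (r (s k)))) i) \<longlonglongrightarrow> l i" for i
    using tendsto_diff[OF s(2)[of i] step[of i]] by simp
  have "stationary l (V l)"
    unfolding stationary_def
  proof (intro allI)
    fix i d
    let ?w = "T (single i d)"
    have "(\<lambda>k. 2 * (?w \<bullet> T (u (Suc (Suc (r (s k))))) - ?w \<bullet> g) + 2 * \<omega> i * (u (Suc (Suc (r (s k)))) i \<bullet> d)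
      + V (u (Suc (r (s k)))) i * (N (u (Suc (Suc (r (s k)))) i + d) - N (u (Suc (Suc (r (s k)))) i)))
     \<longlonglongrightarrow> 2 * (?w \<bullet> T l - ?w \<bullet> g) + 2 * \<omega> i * (l i \<bullet> d) + V l i * (N (l i + d) - N (l i))"
      by (intro tendsto_intros T_weak_limit[OF lim u_l2 u_norm_sum_le] lim N_tendsto V_tendsto s(2))
    moreover have "0 \<le> 2 * (?w \<bullet> T (u (Suc (Suc n))) - ?w \<bullet> g) + 2 * \<omega> i * (u (Suc (Suc n)) i \<bullet> d)
      + V (u (Suc n)) i * (N (u (Suc (Suc n)) i + d) - N (u (Suc (Suc n)) i))" for n
      using u_stationary[of "Suc n", unfolded stationary_def v_eq, rule_format, of i d]
      by (simp add: inner_diff_left inner_diff_right inner_commute)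
    ultimately have "0 \<le> 2 * (?w \<bullet> T l - ?w \<bullet> g) + 2 * \<omega> i * (l i \<bullet> d) + V l i * (N (l i + d) - N (l i))"
      by (intro tendsto_lowerbound[OF _ always_eventually]) auto
    then show "0 \<le> 2 * ((T l - g) \<bullet> ?w) + 2 * \<omega> i * (l i \<bullet> d) + V l i * (N (l i + d) - N (l i))"
      by (simp add: inner_diff_left inner_commute)
  qed
  with s l show thesis using that by blast
qed

text \<open>The joint minimizer is found as a cluster point of the iteration itself.\<close>

lemma stationary_exists: "\<exists>x. x \<in> l2_space \<and> stationary x (V x)"
proof -
  have "strict_mono (\<lambda>k::nat. k)" by (simp add: strict_mono_def)
  then show ?thesis by (rule stationary_cluster_point) (intro exI conjI)
qed

section \<open>Convergence to the unique joint minimizer\<close>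

context
  fixes x
  assumes x: "x \<in> l2_space" "stationary x (V x)"
begin

lemma x_feasible: "feasible x (V x)"
  by (rule stationary_joint_minimizer(1)[OF x u_feasible])

text \<open>Two distinct such points would each have strictly smaller energy than the other.\<close>

lemma stationary_eq:
  assumes "l \<in> l2_space" "stationary l (V l)"
  shows "l = x"
proof (rule ccontr)
  assume "l \<noteq> x"
  then have "E x (V x) < E l (V l)"
    by (intro stationary_joint_minimizer(2)[OF x stationary_joint_minimizer(1)[OF assms u_feasible]]) auto
  moreover have "E l (V l) < E x (V x)"
    using \<open>l \<noteq> x\<close> by (intro stationary_joint_minimizer(2)[OF assms x_feasible]) auto
  ultimately show False by simp
qed

text \<open>Every subsequence has a further one converging to a stationary point, and there is only
  one such point.\<close>

lemma u_pointwise: "(\<lambda>n. u (Suc n) i) \<longlonglongrightarrow> x i"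
proof (rule tendsto_if_subsubseq)
  fix r :: "nat \<Rightarrow> nat" assume r: "strict_mono r"
  obtain s :: "nat \<Rightarrow> nat" and l where s: "strict_mono s" "\<And>i. (\<lambda>k. u (Suc (r (s k))) i) \<longlonglongrightarrow> l i"
    "l \<in> l2_space" "stationary l (V l)"
    by (rule stationary_cluster_point[OF r]) (rule that)
  have "(\<lambda>k. u (Suc (r (s k))) i) \<longlonglongrightarrow> x i"
    using s(2)[of i] by (simp add: stationary_eq[OF s(3,4)])
  with s(1) show "\<exists>s. strict_mono s \<and> (\<lambda>k. u (Suc (r (s k))) i) \<longlonglongrightarrow> x i" by blast
qed

lemma v_pointwise: "(\<lambda>n. v (Suc n) i) \<longlonglongrightarrow> V x i"
  unfolding v_eq by (intro V_tendsto u_pointwise)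

lemma u_weak: "l2_weakly_tendsto (\<lambda>n. u (Suc n)) x"
  unfolding l2_weakly_tendsto_def l2_inner_def
  using l2_weak_limit[OF u_pointwise u_l2 u_norm_sum_le] by (simp add: inner_commute)

text \<open>The weight \<open>\<omega>\<close> matches the hypothesis
  \<open>\<sigma> \<le> \<theta> i * \<omega> i\<close>: it lets the factor
  \<open>1 / \<theta> i\<close> from \<open>V_abs_diff\<close> be replaced by
  \<open>\<omega> i / \<sigma>\<close> in every block.\<close>

definition err :: "nat \<Rightarrow> real" where
  "err n = (\<Sum>\<^sub>\<infinity>i. \<omega> i * (norm (u (Suc n) i - x i))\<^sup>2)"

lemma err_summable: "(\<lambda>i. \<omega> i * (norm (u (Suc n) i - x i))\<^sup>2) summable_on UNIV"
proof (rule summable_on_comparison_test)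
  show "(\<lambda>i. 2 * (\<omega> i * (norm (u (Suc n) i))\<^sup>2) + 2 * (\<omega> i * (norm (x i))\<^sup>2)) summable_on UNIV"
    by (intro summable_on_add summable_on_cmult_right weighted_summable[OF uv_feasible]
        weighted_summable[OF x_feasible])
  fix i
  from mult_left_mono[OF norm_diff_power2_le, of "\<omega> i" "u (Suc n) i" "x i"]
  show "\<omega> i * (norm (u (Suc n) i - x i))\<^sup>2 \<le> 2 * (\<omega> i * (norm (u (Suc n) i))\<^sup>2) + 2 * (\<omega> i * (norm (x i))\<^sup>2)"
    using \<omega>_pos[of i] by (simp add: algebra_simps)
qed (use \<omega>_pos in \<open>simp add: less_imp_le\<close>)

lemma err_nonneg: "0 \<le> err n"
  unfolding err_def using \<omega>_pos by (intro infsum_nonneg) (simp add: less_imp_le)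

section \<open>Geometric contraction and strong convergence\<close>

context
  fixes \<phi> \<sigma> :: real
  assumes \<phi>: "0 < \<phi>" "\<And>z. N z \<le> sqrt \<phi> * norm z"
    and \<sigma>: "\<phi> / 4 < \<sigma>" "\<And>i. \<sigma> \<le> \<theta> i * \<omega> i"
begin

definition \<kappa> where "\<kappa> = \<phi> / (4 * \<sigma>)"

lemma \<kappa>: "0 < \<kappa>" "\<kappa> < 1"
  using \<phi>(1) \<sigma>(1) by (auto simp: \<kappa>_def field_simps)

text \<open>Stationarity of the new iterate towards \<open>x\<close> and of \<open>x\<close> towards
  the iterate are added. The \<open>N\<close> terms combine to
  \<open>(V ?u' i - V x i) * (N (x i) - N (?u i))\<close>, bounded by the Lipschitz estimates; half
  of the resulting Young bound moves to the left, giving \<open>2 - \<kappa>\<close>.\<close>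

lemma contraction_pointwise:
  "(2 - \<kappa>) * (\<omega> i * (norm (u (Suc (Suc n)) i - x i))\<^sup>2) \<le> \<kappa> * (\<omega> i * (norm (u (Suc n) i - x i))\<^sup>2)
    + 2 * ((T x - T (u (Suc (Suc n)))) \<bullet> T (single i (u (Suc (Suc n)) i - x i)))"
proof -
  let ?u = "u (Suc (Suc n))" and ?u' = "u (Suc n)"
  let ?d = "?u i - x i"
  have Tm: "T (single i (- ?d)) = - T (single i ?d)"
    using T_single_scale[of i "-1" ?d] by simp
  have 1: "0 \<le> 2 * ((T ?u - g) \<bullet> T (single i (- ?d))) + 2 * \<omega> i * (?u i \<bullet> (- ?d))
      + V ?u' i * (N (x i) - N (?u i))"
    using u_stationary[of "Suc n", unfolded stationary_def v_eq, rule_format, of i "- ?d"] by simp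
  have 2: "0 \<le> 2 * ((T x - g) \<bullet> T (single i ?d)) + 2 * \<omega> i * (x i \<bullet> ?d)
      + V x i * (N (?u i) - N (x i))"
    using x(2)[unfolded stationary_def, rule_format, of i ?d] by simp
  have "2 * \<omega> i * (?u i \<bullet> (- ?d)) + 2 * \<omega> i * (x i \<bullet> ?d) = - (2 * (\<omega> i * (norm ?d)\<^sup>2))"
    unfolding power2_norm_eq_inner by (simp add: algebra_simps inner_commute)
  moreover have "2 * ((T ?u - g) \<bullet> T (single i (- ?d))) + 2 * ((T x - g) \<bullet> T (single i ?d))
      = 2 * ((T x - T ?u) \<bullet> T (single i ?d))"
    unfolding Tm by (simp add: inner_diff_left)
  ultimately have 3: "2 * (\<omega> i * (norm ?d)\<^sup>2) \<le> 2 * ((T x - T ?u) \<bullet> T (single i ?d))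
      + (V ?u' i - V x i) * (N (x i) - N (?u i))"
    using 1 2 by (simp add: algebra_simps)
  have "(V ?u' i - V x i) * (N (x i) - N (?u i)) \<le> \<bar>V ?u' i - V x i\<bar> * \<bar>N (x i) - N (?u i)\<bar>"
    by (simp add: abs_mult[symmetric])
  also have "\<dots> \<le> (sqrt \<phi> * norm (?u' i - x i) / (2 * \<theta> i)) * (sqrt \<phi> * norm ?d)"
  proof (rule mult_mono)
    show "\<bar>V ?u' i - V x i\<bar> \<le> sqrt \<phi> * norm (?u' i - x i) / (2 * \<theta> i)"
      using V_abs_diff[of ?u' i x] divide_right_mono[OF \<phi>(2), of "2 * \<theta> i" "?u' i - x i"] \<theta>_pos[of i]
      by simp
    show "\<bar>N (x i) - N (?u i)\<bar> \<le> sqrt \<phi> * norm ?d"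
      using N_abs_diff[of "?u i" "x i"] \<phi>(2)[of ?d] by simp
  qed (use \<phi>(1) \<theta>_pos[of i] in auto)
  also have "\<dots> = (\<phi> / (2 * \<theta> i)) * (norm (?u' i - x i) * norm ?d)"
    using \<phi>(1) by simp
  \<comment> \<open>This is where \<open>\<sigma> \<le> \<theta> i * \<omega> i\<close> enters, as
    \<open>\<phi> = 4 * \<kappa> * \<sigma>\<close>.\<close>
  also have "\<dots> \<le> (2 * \<kappa> * \<omega> i) * (norm (?u' i - x i) * norm ?d)"
  proof (rule mult_right_mono)
    have "\<phi> = 4 * \<kappa> * \<sigma>" using \<phi>(1) \<sigma>(1) by (simp add: \<kappa>_def)
    also have "\<dots> \<le> 4 * \<kappa> * (\<theta> i * \<omega> i)"
      using \<kappa> \<sigma>(2)[of i] by (intro mult_left_mono) auto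
    finally show "\<phi> / (2 * \<theta> i) \<le> 2 * \<kappa> * \<omega> i" using \<theta>_pos[of i] by (simp add: field_simps)
  qed simp
  also have "\<dots> = \<kappa> * \<omega> i * (2 * norm (?u' i - x i) * norm ?d)" by simp
  also have "\<dots> \<le> \<kappa> * \<omega> i * ((norm (?u' i - x i))\<^sup>2 + (norm ?d)\<^sup>2)"
    using \<kappa> \<omega>_pos[of i] by (intro mult_left_mono sum_squares_bound) auto
  finally show ?thesis using 3 by (simp add: algebra_simps)
qed

lemma contraction: "(2 - \<kappa>) * err (Suc n) \<le> \<kappa> * err n"
proof -
  let ?u = "u (Suc (Suc n))"
  have "((\<lambda>i. (T x - T ?u) \<bullet> T (single i (?u i - x i))) has_sum (T x - T ?u) \<bullet> (T ?u - T x)) UNIV"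
    using T_has_sum[OF l2_diff[OF u_l2 x(1)]] by (simp add: T_diff[OF u_l2 x(1)])
  then have h: "((\<lambda>i. 2 * ((T x - T ?u) \<bullet> T (single i (?u i - x i)))) has_sum
      2 * ((T x - T ?u) \<bullet> (T ?u - T x))) UNIV"
    by (rule has_sum_cmult_right)
  have "(2 - \<kappa>) * err (Suc n) \<le> \<kappa> * err n + 2 * ((T x - T ?u) \<bullet> (T ?u - T x))"
    unfolding err_def
    by (rule has_sum_mono[OF has_sum_cmult_right[OF has_sum_infsum[OF err_summable]]
          has_sum_add[OF has_sum_cmult_right[OF has_sum_infsum[OF err_summable]] h]
          contraction_pointwise])
  moreover have "(T x - T ?u) \<bullet> (T ?u - T x) \<le> 0"
    using inner_ge_zero[of "T x - T ?u"] inner_minus_right[of "T x - T ?u" "T x - T ?u"] by simp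
  ultimately show ?thesis by simp
qed

lemma err_null: "err \<longlonglongrightarrow> 0"
proof -
  \<comment> \<open>The ratio is below 1 exactly because \<open>\<kappa> < 1\<close>.\<close>
  define r where "r = \<kappa> / (2 - \<kappa>)"
  have r: "0 \<le> r" "r < 1" using \<kappa> by (auto simp: r_def field_simps)
  have step: "err (Suc n) \<le> r * err n" for n
    using contraction[of n] \<kappa> by (simp add: r_def field_simps)
  have le: "err n \<le> r ^ n * err 0" for n
  proof (induction n)
    case (Suc n)
    then show ?case using step[of n] mult_left_mono[OF Suc r(1)] by (simp add: mult.assoc)
  qed simp
  have null: "(\<lambda>n. r ^ n * err 0) \<longlonglongrightarrow> 0"
    by (rule tendsto_mult_left_zero[OF LIMSEQ_realpow_zero[OF r]])
  show ?thesis
    by (rule tendsto_sandwich[OF _ _ tendsto_const null]) (simp_all only: le err_nonneg eventually_True)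
qed

lemma norm_sum_null: "(\<lambda>n. \<Sum>\<^sub>\<infinity>i. (norm (u (Suc n) i - x i))\<^sup>2) \<longlonglongrightarrow> 0"
proof -
  have null: "(\<lambda>n. err n / \<gamma>) \<longlonglongrightarrow> 0"
    by (rule tendsto_divide_zero[OF err_null])
  have le: "(\<Sum>\<^sub>\<infinity>i. (norm (u (Suc n) i - x i))\<^sup>2) \<le> err n / \<gamma>" for n
    unfolding err_def by (rule norm_sum_le_weighted(2)[OF err_summable])
  have nonneg: "0 \<le> (\<Sum>\<^sub>\<infinity>i. (norm (u (Suc n) i - x i))\<^sup>2)" for n
    by (rule infsum_nonneg) simp
  show ?thesis
    by (rule tendsto_sandwich[OF _ _ tendsto_const null]) (simp_all only: le nonneg eventually_True)
qed

lemma u_strong: "(\<lambda>n. l2_norm (\<lambda>i. u (Suc n) i - x i)) \<longlonglongrightarrow> 0"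
  unfolding l2_norm_def using tendsto_real_sqrt[OF norm_sum_null] by simp

text \<open>The Lipschitz constant \<open>1 / (2 * \<theta> i)\<close> of \<open>V\<close> cancels
  the weight, leaving the unweighted error of \<open>u\<close>.\<close>

lemma v_diff_le: "(\<theta> i)\<^sup>2 * \<bar>v (Suc n) i - V x i\<bar>\<^sup>2 \<le> (\<phi> / 4) * (norm (u (Suc n) i - x i))\<^sup>2"
proof -
  have "\<theta> i * \<bar>v (Suc n) i - V x i\<bar> \<le> \<theta> i * (N (u (Suc n) i - x i) / (2 * \<theta> i))"
    unfolding v_eq by (rule mult_left_mono[OF V_abs_diff less_imp_le[OF \<theta>_pos]])
  also have "\<dots> \<le> sqrt \<phi> * norm (u (Suc n) i - x i) / 2"
    using \<phi>(2)[of "u (Suc n) i - x i"] \<theta>_pos[of i] by simp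
  finally have "(\<theta> i * \<bar>v (Suc n) i - V x i\<bar>)\<^sup>2 \<le> (sqrt \<phi> * norm (u (Suc n) i - x i) / 2)\<^sup>2"
    using \<theta>_pos[of i] by (intro power_mono) auto
  then show ?thesis using \<phi>(1) by (simp add: power_mult_distrib power_divide)
qed

lemma v_diff_bound_summable: "(\<lambda>i. (\<phi> / 4) * (norm (u (Suc n) i - x i))\<^sup>2) summable_on UNIV"
  using norm_sum_le_weighted(1)[OF err_summable, of n]
  by (intro summable_on_cmult_right) (simp add: l2_space_def)

lemma v_diff_summable: "(\<lambda>i. (\<theta> i)\<^sup>2 * \<bar>v (Suc n) i - V x i\<bar>\<^sup>2) summable_on UNIV"
  by (rule summable_on_comparison_test[OF v_diff_bound_summable v_diff_le]) simp

lemma v_strong: "(\<lambda>n. weighted_l2_norm \<theta> (\<lambda>i. v (Suc n) i - V x i)) \<longlonglongrightarrow> 0"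
proof -
  have null: "(\<lambda>n. (\<phi> / 4) * (\<Sum>\<^sub>\<infinity>i. (norm (u (Suc n) i - x i))\<^sup>2)) \<longlonglongrightarrow> 0"
    by (rule tendsto_mult_right_zero[OF norm_sum_null])
  have le: "(\<Sum>\<^sub>\<infinity>i. (\<theta> i)\<^sup>2 * \<bar>v (Suc n) i - V x i\<bar>\<^sup>2)
      \<le> (\<phi> / 4) * (\<Sum>\<^sub>\<infinity>i. (norm (u (Suc n) i - x i))\<^sup>2)" for n
    unfolding infsum_cmult_right'[symmetric]
    by (rule infsum_mono[OF v_diff_summable v_diff_bound_summable v_diff_le])
  have nonneg: "0 \<le> (\<Sum>\<^sub>\<infinity>i. (\<theta> i)\<^sup>2 * \<bar>v (Suc n) i - V x i\<bar>\<^sup>2)" for n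
    by (rule infsum_nonneg) simp
  have "(\<lambda>n. \<Sum>\<^sub>\<infinity>i. (\<theta> i)\<^sup>2 * \<bar>v (Suc n) i - V x i\<bar>\<^sup>2) \<longlonglongrightarrow> 0"
    by (rule tendsto_sandwich[OF _ _ tendsto_const null]) (simp_all only: le nonneg eventually_True)
  from tendsto_real_sqrt[OF this] show ?thesis by (simp add: weighted_l2_norm_def)
qed

end

end

end

section \<open>Transfer to the extended-valued functional\<close>

lemma Phi_eq:
  fixes x :: "'i \<Rightarrow> real^'m"
  assumes "\<And>i. 0 \<le> \<omega> i" "\<And>i. 0 \<le> \<theta> i" "\<And>i. 0 \<le> y i"
  shows "Phi q \<omega> \<theta> \<rho> x y =
    (let f = \<lambda>i. y i * lq_norm q (x i) + \<omega> i * (norm (x i))\<^sup>2 + \<theta> i * (\<rho> i - y i)\<^sup>2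
     in if f summable_on UNIV then ennreal (infsum f UNIV) else \<infinity>)"
proof -
  have s: "h summable_on UNIV" for h :: "'i \<Rightarrow> ennreal"
    by (rule nonneg_summable_on_complete) simp
  have "Phi q \<omega> \<theta> \<rho> x y = (\<Sum>\<^sub>\<infinity>i. ennreal (y i * lq_norm q (x i)) + ennreal (\<omega> i * (norm (x i))\<^sup>2)
      + ennreal (\<theta> i * (\<rho> i - y i)\<^sup>2))"
    unfolding Phi_def by (simp add: infsum_add[OF s s])
  also have "\<dots> = (\<Sum>\<^sub>\<infinity>i. ennreal (y i * lq_norm q (x i) + \<omega> i * (norm (x i))\<^sup>2 + \<theta> i * (\<rho> i - y i)\<^sup>2))"
    using assms by (intro infsum_cong) (simp add: ennreal_plus lq_norm_nonneg)
  finally show ?thesis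
    using assms by (subst (asm) ennreal_infsum) (auto simp: Let_def lq_norm_nonneg)
qed

lemma lq_norm_0: "1 \<le> q \<Longrightarrow> lq_norm q (0 :: real^'m) = 0"
  using lq_norm_scale[of q 0 0] by simp

text \<open>Taking \<open>\<rho>\<close> as second argument outside \<open>i\<close> makes every
  other block vanish, including its quadratic penalty.\<close>

lemma Phi_single:
  fixes z :: "real^'m"
  assumes "1 \<le> q" "\<And>i. 0 \<le> \<omega> i" "\<And>i. 0 \<le> \<theta> i" "\<And>i. 0 \<le> \<rho> i" "0 \<le> y"
  shows "Phi q \<omega> \<theta> \<rho> (single i z) (\<rho>(i := y))
    = ennreal (y * lq_norm q z + \<omega> i * (norm z)\<^sup>2 + \<theta> i * (\<rho> i - y)\<^sup>2)"
proof -
  let ?f = "\<lambda>j. (\<rho>(i := y)) j * lq_norm q (single i z j) + \<omega> j * (norm (single i z j))\<^sup>2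
      + \<theta> j * (\<rho> j - (\<rho>(i := y)) j)\<^sup>2"
  have "(?f has_sum ?f i) UNIV"
    by (rule has_sum_single_support) (simp add: single_def lq_norm_0[OF assms(1)])
  then have "?f summable_on UNIV" "infsum ?f UNIV = y * lq_norm q z + \<omega> i * (norm z)\<^sup>2 + \<theta> i * (\<rho> i - y)\<^sup>2"
    by (auto simp: has_sum_imp_summable single_def dest: infsumI)
  then show ?thesis
    using assms by (subst Phi_eq) (auto simp: Let_def)
qed

text \<open>One block embeds into the full space by 0 and \<open>\<rho>\<close> elsewhere; convex
  combinations respect this embedding, so strict convexity of \<open>Phi\<close> restricts to the
  block.\<close>

lemma phi_strictly_convex:
  fixes z z' :: "real^'m" and i :: 'i
  assumes q: "1 \<le> q" and pos: "\<And>i. 0 < \<omega> i" "\<And>i. 0 < \<theta> i" "\<And>i. 0 < \<rho> i"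
    and strict: "strictly_convex_where_finite (l2_space :: ('i \<Rightarrow> real ^ 'm) set) (linf_cone \<rho>) (Phi q \<omega> \<theta> \<rho>)"
    and y: "0 \<le> y" "0 \<le> y'" and t: "0 < t" "t < 1" and ne: "(z, y) \<noteq> (z', y')"
  defines "f \<equiv> \<lambda>z y. y * lq_norm q z + \<omega> i * (norm z)\<^sup>2 + \<theta> i * (\<rho> i - y)\<^sup>2"
  shows "f (t *\<^sub>R z + (1 - t) *\<^sub>R z') (t * y + (1 - t) * y') < t * f z y + (1 - t) * f z' y'"
proof -
  have nonneg: "0 \<le> \<omega> j" "0 \<le> \<theta> j" "0 \<le> \<rho> j" for j using pos by (auto simp: less_imp_le)
  have l2: "single i c \<in> l2_space" for c :: "real^'m"
    unfolding single_def by (intro l2_fun_upd) (simp add: l2_space_def)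
  have cone: "\<rho>(i := c) \<in> linf_cone \<rho>" if "0 \<le> c" for c
    unfolding linf_cone_def using that nonneg pos(3)
    by (auto intro!: bdd_aboveI[of _ "max 1 (c / \<rho> i)"] simp: less_imp_neq[symmetric])
  have Phi: "Phi q \<omega> \<theta> \<rho> (single i c) (\<rho>(i := e)) = ennreal (f c e)" if "0 \<le> e" for c e
    unfolding f_def by (rule Phi_single[OF q nonneg that])
  have f0: "0 \<le> f c e" if "0 \<le> e" for c e
    using that nonneg by (simp add: f_def lq_norm_nonneg)
  have "(single i z, \<rho>(i := y)) \<noteq> (single i z', \<rho>(i := y'))"
    using ne by (auto simp: single_def dest: fun_cong[of _ _ i])
  moreover have "Phi q \<omega> \<theta> \<rho> (single i z) (\<rho>(i := y)) < \<infinity>" "Phi q \<omega> \<theta> \<rho> (single i z') (\<rho>(i := y')) < \<infinity>"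
    using y by (simp_all add: Phi)
  ultimately have "Phi q \<omega> \<theta> \<rho> (\<lambda>j. t *\<^sub>R single i z j + (1 - t) *\<^sub>R single i z' j)
      (\<lambda>j. t * (\<rho>(i := y)) j + (1 - t) * (\<rho>(i := y')) j)
    < ennreal t * Phi q \<omega> \<theta> \<rho> (single i z) (\<rho>(i := y)) + ennreal (1 - t) * Phi q \<omega> \<theta> \<rho> (single i z') (\<rho>(i := y'))"
    using strict[unfolded strictly_convex_where_finite_def, rule_format, OF l2 cone[OF y(1)] l2 cone[OF y(2)] t]
    by blast
  moreover have "(\<lambda>j. t *\<^sub>R single i z j + (1 - t) *\<^sub>R single i z' j) = single i (t *\<^sub>R z + (1 - t) *\<^sub>R z')"
    by (auto simp: single_def)
  moreover have "(\<lambda>j. t * (\<rho>(i := y)) j + (1 - t) * (\<rho>(i := y')) j) = \<rho>(i := t * y + (1 - t) * y')"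
    by (auto simp: algebra_simps)
  ultimately have "ennreal (f (t *\<^sub>R z + (1 - t) *\<^sub>R z') (t * y + (1 - t) * y'))
      < ennreal t * ennreal (f z y) + ennreal (1 - t) * ennreal (f z' y')"
    using y t by (simp add: Phi)
  also have "\<dots> = ennreal (t * f z y + (1 - t) * f z' y')"
    using y t f0 by (simp add: ennreal_mult ennreal_plus)
  finally show ?thesis
    using y t by (subst (asm) ennreal_less_iff) (auto intro: f0)
qed

lemma is_arg_min_iff_eq:
  fixes f :: "'a \<Rightarrow> 'b::order"
  assumes "P a" "\<And>z. P z \<Longrightarrow> z \<noteq> a \<Longrightarrow> f a < f z"
  shows "is_arg_min f P z \<longleftrightarrow> z = a"
  using assms unfolding is_arg_min_def by (metis order.asym)

text \<open>\<open>arg_min_on\<close> is a choice; a strict minimizer leaves it only one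
  value.\<close>

lemma arg_min_on_eq:
  fixes f :: "'a \<Rightarrow> 'b::order"
  assumes "a \<in> S" "\<And>z. z \<in> S \<Longrightarrow> z \<noteq> a \<Longrightarrow> f a < f z"
  shows "arg_min_on f S = a"
proof -
  have "is_arg_min f (\<lambda>x. x \<in> S) = (\<lambda>z. z = a)"
    by (rule ext) (rule is_arg_min_iff_eq; use assms in blast)
  then show ?thesis by (simp add: arg_min_on_def arg_min_def)
qed

text \<open>The summands of the direct sum are closed subspaces \<open>Hs j\<close> of one ambient
  Hilbert space. As \<open>arg_min_on\<close> always returns something, the first conjunct asserts
  that each step has exactly one minimizer. Membership in \<open>weighted_l2_space\<close> is
  claimed from \<open>n = 1\<close> on, as \<open>v 0\<close> is a free starting value.\<close>

theorem theorem3p1: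
  fixes \<psi> :: "'i::countable \<Rightarrow> 'k::{real_inner, polish_space}"
    and Hs :: "'n::finite \<Rightarrow> 'h::{real_inner, polish_space} set"
    and A :: "'m::finite \<Rightarrow> 'n \<Rightarrow> 'k \<Rightarrow> 'h"
    and g :: "'h ^ 'n"
    and \<omega> \<theta> \<rho> :: "'i \<Rightarrow> real"
    and q :: ennreal
    and \<gamma> :: real
    and u :: "nat \<Rightarrow> 'i \<Rightarrow> real ^ 'm"
    and v :: "nat \<Rightarrow> 'i \<Rightarrow> real"
  defines "J \<equiv> J_fun A \<psi> g q \<omega> \<theta> \<rho>"
  assumes Hs: "\<And>j. subspace (Hs j)" "\<And>j. closed (Hs j)"
    and g: "\<And>j. g $ j \<in> Hs j"
    and A: "\<And>l j. bounded_linear (A l j)" "\<And>l j. range (A l j) \<subseteq> Hs j"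
    and frame: "is_frame \<psi>"
    and pos: "\<And>i. 0 < \<omega> i" "\<And>i. 0 < \<theta> i" "\<And>i. 0 < \<rho> i"
    and q: "1 \<le> q"
    and strict: "strictly_convex_where_finite (l2_space :: ('i \<Rightarrow> real ^ 'm) set) (linf_cone \<rho>)
                   (Phi q \<omega> \<theta> \<rho>)"
    and gamma: "0 < \<gamma>" "\<And>i. \<gamma> \<le> \<omega> i"
    and v0: "v 0 \<in> linf_cone \<rho>" "\<exists>x\<in>l2_space. J x (v 0) < \<infinity>"
    and u_step: "\<And>n. 1 \<le> n \<Longrightarrow> u n = arg_min_on (\<lambda>x. J x (v (n - 1))) l2_space"
    and v_step: "\<And>n. 1 \<le> n \<Longrightarrow> v n = arg_min_on (\<lambda>y. J (u n) y) (linf_cone \<rho>)"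
  shows
    "(\<forall>n\<ge>1. (\<forall>x. is_arg_min (\<lambda>x. J x (v (n - 1))) (\<lambda>x. x \<in> l2_space) x \<longleftrightarrow> x = u n) \<and>
             (\<forall>y. is_arg_min (\<lambda>y. J (u n) y) (\<lambda>y. y \<in> linf_cone \<rho>) y \<longleftrightarrow> y = v n)) \<and>
     (\<exists>ustar vstar.
        (\<forall>p. is_arg_min (\<lambda>(x, y). J x y) (\<lambda>p. p \<in> l2_space \<times> linf_cone \<rho>) p
              \<longleftrightarrow> p = (ustar, vstar)) \<and>
        l2_weakly_tendsto u ustar \<and>
        (\<forall>i. (\<lambda>n. v n i) \<longlonglongrightarrow> vstar i) \<and>
        (q \<in> {1, 2, \<infinity>} \<and> (\<exists>\<sigma>>phi_const q CARD('m) / 4. \<forall>i. \<sigma> \<le> \<theta> i * \<omega> i) \<longrightarrow>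
           (\<lambda>n. l2_norm (\<lambda>i. u n i - ustar i)) \<longlonglongrightarrow> 0 \<and>
           (\<forall>n\<ge>1. (\<lambda>i. v n i - vstar i) \<in> weighted_l2_space \<theta>) \<and>
           (\<lambda>n. weighted_l2_norm \<theta> (\<lambda>i. v n i - vstar i)) \<longlonglongrightarrow> 0))"
proof -
  let ?T = "T_op A \<psi>"
  interpret J: joint_sparsity_functional ?T g "lq_norm q" \<omega> \<theta> \<rho> \<gamma>
    by unfold_locales
      (rule T_op_adjoint[OF frame A(1)] lq_norm_scale[OF q] lq_norm_triangle[OF q] pos gamma)+
  interpret J: strictly_convex_functional ?T g "lq_norm q" \<omega> \<theta> \<rho> \<gamma>
    by unfold_locales (unfold J.phi_def, rule phi_strictly_convex[OF q pos strict])
  have cone_nonneg: "0 \<le> y i" if "y \<in> linf_cone \<rho>" for y i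
    using that by (simp add: linf_cone_def)
  have J_feasible: "J x y = ennreal (J.E x y)" if "J.feasible x y" for x y
    using that pos J.infsum_phi_nonneg[OF that]
    by (simp add: J_def J_fun_def J.feasible_def Phi_eq less_imp_le J.E_def ennreal_plus J.phi_def[abs_def])
  have J_infeasible: "J x y = \<infinity>" if "\<not> J.feasible x y" "x \<in> l2_space" "y \<in> linf_cone \<rho>" for x y
    using that pos cone_nonneg[OF that(3)]
    by (simp add: J_def J_fun_def J.feasible_def Phi_eq less_imp_le J.phi_def[abs_def])
  \<comment> \<open>An infeasible competitor has the value infinity, so a strict inequality for
    \<open>E\<close> is only due against feasible ones.\<close>
  have J_less: "J x y < J x' y'"
    if "J.feasible x y" "x' \<in> l2_space" "y' \<in> linf_cone \<rho>" "J.feasible x' y' \<Longrightarrow> J.E x y < J.E x' y'"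
    for x y x' y'
    using that J.E_nonneg[OF that(1)]
    by (cases "J.feasible x' y'") (auto simp: J_feasible J_infeasible ennreal_less_iff)
  have V_cone: "J.V x \<in> linf_cone \<rho>" for x
    unfolding linf_cone_def using J.V_nonneg J.V_le pos(3)
    by (auto intro!: bdd_aboveI[of _ 1] simp: divide_le_eq_1_pos)
  have V_less: "J x (J.V x) < J x y'" if "J.feasible x y" "y' \<in> linf_cone \<rho>" "y' \<noteq> J.V x" for x y y'
    using J.V_minimal[of x] that J.V_minimal(1)[OF that(1)] by (intro J_less) (auto simp: J.feasible_def[of x y])
  have u_min: "\<exists>a. J.feasible a y \<and> J.stationary a y \<and> (\<forall>z\<in>l2_space. z \<noteq> a \<longrightarrow> J a y < J z y)"
    if x: "J.feasible x y" and y: "y \<in> linf_cone \<rho>" for x y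
  proof -
    obtain a where a: "J.feasible a y" "\<And>z. J.feasible z y \<Longrightarrow> J.E a y \<le> J.E z y"
      using J.minimizer_exists[OF x] by blast
    have st: "J.stationary a y" by (rule J.minimizer_stationary[OF a])
    have "J a y < J z y" if "z \<in> l2_space" "z \<noteq> a" for z
      using that a(1) st J.stationary_unique[of a y z]
      by (intro J_less[OF _ _ y]) (auto simp: J.feasible_def[of a y])
    then show ?thesis using a(1) st by blast
  qed
  have step: "J.feasible (u (Suc n)) (v n) \<and> J.stationary (u (Suc n)) (v n) \<and>
      (\<forall>z\<in>l2_space. z \<noteq> u (Suc n) \<longrightarrow> J (u (Suc n)) (v n) < J z (v n)) \<and> v (Suc n) = J.V (u (Suc n))"
    if inv: "v n \<in> linf_cone \<rho>" "J.feasible x (v n)" for n x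
  proof -
    obtain a where a: "J.feasible a (v n)" "J.stationary a (v n)"
      "\<And>z. z \<in> l2_space \<Longrightarrow> z \<noteq> a \<Longrightarrow> J a (v n) < J z (v n)"
      using u_min[OF inv(2,1)] by blast
    have "a \<in> l2_space" using a(1) by (simp add: J.feasible_def)
    then have u_eq: "u (Suc n) = a"
      using arg_min_on_eq[of a l2_space "\<lambda>x. J x (v n)"] a(3) u_step[of "Suc n"] by simp
    have "v (Suc n) = J.V a"
      using arg_min_on_eq[of "J.V a" "linf_cone \<rho>" "\<lambda>y. J a y"] V_cone[of a] V_less[OF a(1)] v_step[of "Suc n"]
      by (simp add: u_eq)
    then show ?thesis using a by (simp add: u_eq)
  qed
  \<comment> \<open>\<open>u_min\<close> needs one feasible partner for \<open>v n\<close>: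
    finiteness of \<open>J\<close> provides it for \<open>v 0\<close>, and \<open>u (Suc n)\<close>
    itself is one for \<open>v (Suc n)\<close>.\<close>
  have inv: "v n \<in> linf_cone \<rho> \<and> (\<exists>x. J.feasible x (v n))" for n
  proof (induction n)
    case 0
    then show ?case using v0 J_infeasible by (metis less_irrefl)
  next
    case (Suc n)
    then obtain x where x: "v n \<in> linf_cone \<rho>" "J.feasible x (v n)" by blast
    show ?case using step[OF x] V_cone J.V_minimal(1) by metis
  qed
  have seq: "J.feasible (u (Suc n)) (v n)" "J.stationary (u (Suc n)) (v n)"
    "v (Suc n) = J.V (u (Suc n))" "\<And>z. z \<in> l2_space \<Longrightarrow> z \<noteq> u (Suc n) \<Longrightarrow> J (u (Suc n)) (v n) < J z (v n)" for n
    using step inv by blast+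
  interpret J: alternating_minimization ?T g "lq_norm q" \<omega> \<theta> \<rho> \<gamma> u v
    by unfold_locales (rule seq)+
  have argmins: "(\<forall>x. is_arg_min (\<lambda>x. J x (v (n - 1))) (\<lambda>x. x \<in> l2_space) x \<longleftrightarrow> x = u n) \<and>
             (\<forall>y. is_arg_min (\<lambda>y. J (u n) y) (\<lambda>y. y \<in> linf_cone \<rho>) y \<longleftrightarrow> y = v n)" if n1: "1 \<le> n" for n
  proof -
    obtain m where n: "n = Suc m" using n1 by (cases n) auto
    show ?thesis
      unfolding n diff_Suc_1
      using V_less[OF seq(1)[of m]] V_cone seq(4)[of _ m] J.u_l2[of m] seq(3)[of m]
      by (intro conjI allI is_arg_min_iff_eq) auto
  qed
  obtain x where x: "x \<in> l2_space" "J.stationary x (J.V x)"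
    using J.stationary_exists by blast
  have min: "is_arg_min (\<lambda>(x, y). J x y) (\<lambda>p. p \<in> l2_space \<times> linf_cone \<rho>) p \<longleftrightarrow> p = (x, J.V x)" for p
  proof (rule is_arg_min_iff_eq)
    show "(x, J.V x) \<in> l2_space \<times> linf_cone \<rho>" using x(1) V_cone by simp
    fix p assume p: "p \<in> l2_space \<times> linf_cone \<rho>" "p \<noteq> (x, J.V x)"
    have "J x (J.V x) < J (fst p) (snd p)"
      using p J.stationary_joint_minimizer(2)[OF x, of "fst p" "snd p"]
      by (intro J_less J.x_feasible[OF x]) auto
    then show "(case (x, J.V x) of (x, y) \<Rightarrow> J x y) < (case p of (x, y) \<Rightarrow> J x y)"
      by (simp add: case_prod_beta)
  qed
  have weak: "l2_weakly_tendsto u x"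
    using J.u_weak[OF x] unfolding l2_weakly_tendsto_def by (auto intro: LIMSEQ_imp_Suc)
  have vlim: "(\<lambda>n. v n i) \<longlonglongrightarrow> J.V x i" for i
    by (rule LIMSEQ_imp_Suc[OF J.v_pointwise[OF x]])
  have strong: "(\<lambda>n. l2_norm (\<lambda>i. u n i - x i)) \<longlonglongrightarrow> 0 \<and>
           (\<forall>n\<ge>1. (\<lambda>i. v n i - J.V x i) \<in> weighted_l2_space \<theta>) \<and>
           (\<lambda>n. weighted_l2_norm \<theta> (\<lambda>i. v n i - J.V x i)) \<longlonglongrightarrow> 0"
    if q': "q \<in> {1, 2, \<infinity>}" and \<sigma>: "phi_const q CARD('m) / 4 < \<sigma>" "\<And>i. \<sigma> \<le> \<theta> i * \<omega> i" for \<sigma>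
  proof -
    have \<phi>: "0 < phi_const q CARD('m)" by (simp add: phi_const_def)
    note c = \<phi> lq_norm_le_phi_const[OF q'] \<sigma>
    have "(\<lambda>i. v n i - J.V x i) \<in> weighted_l2_space \<theta>" if "1 \<le> n" for n
      using J.v_diff_summable[OF x c, of "n - 1"] that by (simp add: weighted_l2_space_def)
    then show ?thesis
      using LIMSEQ_imp_Suc[OF J.u_strong[OF x c]] LIMSEQ_imp_Suc[OF J.v_strong[OF x c]] by blast
  qed
  show ?thesis
    by (intro conjI exI[of _ x] exI[of _ "J.V x"])
      (use argmins min weak vlim strong in blast)+
qed

end
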